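(* Let $P$ be a process of the calculus $\mathsf{s}\pi^{+}$ and $\Gamma$ a typing context such that $P \vdash \Gamma$. Then for every process $Q$: if $P \equiv Q$ then $Q \vdash \Gamma$; and for every $Q$ and every non-empty set of names $S$, if $P \leadsto_S Q$ then $Q \vdash \Gamma$.
   Context: The calculus $\mathsf{s}\pi^{+}$ (a session-typed $\pi$-calculus with non-deterministic choice). Names are $x,y,z,w,\dots$; $\widetilde{x}$ is a finite tuple of names. Processes: $P,Q ::= \mathbf{0}$ (inaction) $\mid [x\leftrightarrow y]$ (forwarder) $\mid (\nu x)(P \mid Q)$ (connect) $\mid P \boxplus Q$ (non-deterministic choice) $\mid \overline{x}[y];(P\mid Q)$ (output of a fresh name $y$) $\mid x(y);P$ (input) $\mid \overline{x}\triangleleft \ell;P$ (select label $\ell$) $\mid x\triangleright\{i:P_i\}_{i\in I}$ (branch, $I$ finite) $\mid \overline{x}[\,]$ (close) $\mid x();P$ (wait) $\mid x.\mathtt{some}_{(w_1,\dots,w_n)};P$ (expect) $\mid \overline{x}.\mathtt{some};P$ (available) $\mid \overline{x}.\mathtt{none}$ (unavailable) $\mid P\mid Q$ (parallel). Name $y$ is bound in $(\nu y)(P\mid Q)$, $\overline{x}[y];(P\mid Q)$, $x(y);P$; $\mathrm{fn}(P)$ is the set of free names. $\boxplus$ is associative; $\boxplus_{i\in I}P_i$ is the choice among all $P_i$. $P\{y/z\}$ is capture-avoiding substitution. In the subscript of expect, names and sets of names are freely combined (union). Structural congruence $\equiv$ is the least congruence with: $P\equiv P'$ if $\alpha$-equivalent;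 $[x\leftrightarrow y]\equiv[y\leftrightarrow x]$; $P\mid \mathbf 0\equiv P$; $(P\mid Q)\mid R\equiv P\mid(Q\mid R)$; $P\mid Q\equiv Q\mid P$; $(\nu x)(P\mid Q)\equiv(\nu x)(Q\mid P)$; $P\boxplus P\equiv P$; $P\boxplus Q\equiv Q\boxplus P$; $(P\boxplus Q)\boxplus R\equiv P\boxplus(Q\boxplus R)$; $(\nu x)((P\mid Q)\mid R)\equiv(\nu x)(P\mid R)\mid Q$ if $x\notin\mathrm{fn}(Q)$; $(\nu x)((\nu y)(P\mid Q)\mid R)\equiv(\nu y)((\nu x)(P\mid R)\mid Q)$ if $x\notin\mathrm{fn}(Q)$, $y\notin\mathrm{fn}(R)$. ND-contexts: $N ::= [\cdot]\mid N\mid P\mid (\nu x)(N\mid P)\mid N\boxplus P$; D-contexts $C,D$ are ND-contexts not using the clause $N\boxplus P$. $N[P]$ is hole-filling. Prefixes: $\alpha,\beta ::= \overline{x}[y]\mid x(y)\mid \overline{x}\triangleleft\ell\mid x\triangleright\mid \overline{x}[\,]\mid x()\mid \overline{x}.\mathtt{some}\mid\overline{x}.\mathtt{none}\mid x.\mathtt{some}_{\widetilde{w}}\mid[x\leftrightarrow y]$, with subjects $\mathrm{sub}([x\leftrightarrow y])=\{x,y\}$ and $\mathrm{sub}(\alpha)=\{x\}$ otherwise; $\alpha;P$ denotes a prefixed process. Let $\bowtie$ be the least relation with $\overline{x}[y]\bowtie\overline{x}[z]$, $x(y)\bowtie x(z)$, and $\alpha\bowtie\alpha$. Precongruence $P \succeq_S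 Q$ (for non-empty $S\subseteq\{x,y\}$) holds when: (1) if $S=\{x\}$ then $P=(\boxplus_{i\in I}C_i[\alpha_i;P_i])\boxplus(\boxplus_{j\in J}C_j[\beta_j;Q_j])$ and $Q=\boxplus_{i\in I}C_i[\alpha_i;P_i]$ with all $\alpha_i\bowtie\alpha_{i'}$, $\mathrm{sub}(\alpha_i)=\{x\}$, and for all $i,j$: $\alpha_i\not\bowtie\beta_j$ and $x\in\mathrm{fn}(\beta_j;Q_j)$; (2) if $S=\{x,y\}$ then $P=(\boxplus_{i\in I}C_i[[x\leftrightarrow y]])\boxplus(\boxplus_{j\in J}C_j[[x\leftrightarrow z_j]])\boxplus(\boxplus_{k\in K}C_k[\alpha_k;P_k])$ and $Q=\boxplus_{i\in I}C_i[[x\leftrightarrow y]]$ with $z_j\neq y$, $x\in\mathrm{fn}(\alpha_k;P_k)$ and $\alpha_k\not\bowtie[x\leftrightarrow z]$ for all $z$. (Here $C_i,C_j,C_k,D_j$ are D-contexts.) Reduction $\leadsto_S$ (writing $\leadsto_{x}$ for $\leadsto_{\{x\}}$): (Id) $(\nu x)(\boxplus_{i\in I}C_i[[x\leftrightarrow y]]\mid Q)\leadsto_{x,y}\boxplus_{i\in I}C_i[Q\{y/x\}]$. (Comm) $(\nu x)(\boxplus_{i}C_i[\overline{x}[y_i];(P_i\mid Q_i)]\mid\boxplus_{j}D_j[x(z);R_j])\leadsto_x\boxplus_i C_i[(\nu x)(Q_i\mid(\nu w)(P_i\{w/y_i\}\mid\boxplus_j D_j[R_j\{w/z\}]))]$.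 (Sel) $(\nu x)(\boxplus_iC_i[\overline{x}\triangleleft k';P_i]\mid\boxplus_jD_j[x\triangleright\{k:Q^k_j\}_{k\in K}])\leadsto_x(\nu x)(\boxplus_iC_i[P_i]\mid\boxplus_jD_j[Q^{k'}_j])$ if $k'\in K$. (Close) $(\nu x)(\boxplus_iC_i[\overline{x}[\,]]\mid\boxplus_jD_j[x();Q_j])\leadsto_x\boxplus_iC_i[\mathbf 0]\mid\boxplus_jD_j[Q_j]$. (Some) $(\nu x)(\boxplus_iC_i[\overline{x}.\mathtt{some};P_i]\mid\boxplus_jD_j[x.\mathtt{some}_{(w_1,\dots,w_n)};Q_j])\leadsto_x(\nu x)(\boxplus_iC_i[P_i]\mid\boxplus_jD_j[Q_j])$. (None) $(\nu x)(\boxplus_iC_i[\overline{x}.\mathtt{none}]\mid\boxplus_jD_j[x.\mathtt{some}_{(w_1,\dots,w_n)};Q_j])\leadsto_x\boxplus_iC_i[\mathbf 0]\mid\boxplus_jD_j[\overline{w_1}.\mathtt{none}\mid\dots\mid\overline{w_n}.\mathtt{none}]$. ($\succeq$) if $x\in S$, $P\succeq_S P'$, $Q\succeq_S Q'$ and $(\nu x)(P'\mid Q')\leadsto_S R$ then $(\nu x)(P\mid Q)\leadsto_S R$. ($\nu\boxplus$) if $(\nu x)(P\mid N[C[Q_1]\boxplus C[Q_2]])\leadsto_S R$ then $(\nu x)(P\mid N[C[Q_1\boxplus Q_2]])\leadsto_S R$. Closure: if $P\equiv P'\leadsto_S Q'\equiv Q$ then $P\leadsto_S Q$; if $P\leadsto_S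 P'$ then $(\nu x)(P\mid Q)\leadsto_S(\nu x)(P'\mid Q)$, $P\mid Q\leadsto_S P'\mid Q$, and $P\boxplus Q\leadsto_S P'\boxplus Q$. Session types: $A,B::=\mathbf 1\mid\bot\mid A\otimes B\mid A\wp B\mid\oplus\{i:A_i\}_{i\in I}\mid\&\{i:A_i\}_{i\in I}\mid\& A\mid\oplus A$ ($\wp$ is the multiplicative disjunction "par"). Duality $\overline{\cdot}$: $\overline{\mathbf 1}=\bot$, $\overline{\bot}=\mathbf 1$, $\overline{A\otimes B}=\overline A\wp\overline B$, $\overline{A\wp B}=\overline A\otimes\overline B$, $\overline{\oplus\{i:A_i\}}=\&\{i:\overline{A_i}\}$, $\overline{\&\{i:A_i\}}=\oplus\{i:\overline{A_i}\}$, $\overline{\&A}=\oplus\overline A$, $\overline{\oplus A}=\&\overline A$. Contexts $\Gamma$ are finite sets of assignments $x:A$ with distinct names; $\&\Gamma$ means every type in $\Gamma$ has the form $\&A'$. Typing rules for $P\vdash\Gamma$: (cut) from $P\vdash\Gamma,x:A$ and $Q\vdash\Delta,x:\overline A$ infer $(\nu x)(P\mid Q)\vdash\Gamma,\Delta$; (mix) from $P\vdash\Gamma$, $Q\vdash\Delta$ infer $P\mid Q\vdash\Gamma,\Delta$; ($\boxplus$) from $P\vdash\Gamma$, $Q\vdash\Gamma$ infer $P\boxplus Q\vdash\Gamma$; $\mathbf 0\vdash\emptyset$; $[x\leftrightarrow y]\vdash x:A,y:\overline A$; $\overline{x}[\,]\vdash x:\mathbf 1$; from $P\vdash\Gamma$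 infer $x();P\vdash\Gamma,x:\bot$; from $P\vdash\Gamma,y:A$ and $Q\vdash\Delta,x:B$ infer $\overline{x}[y];(P\mid Q)\vdash\Gamma,\Delta,x:A\otimes B$; from $P\vdash\Gamma,y:A,x:B$ infer $x(y);P\vdash\Gamma,x:A\wp B$; from $P\vdash\Gamma,x:A_j$, $j\in I$ infer $\overline{x}\triangleleft j;P\vdash\Gamma,x:\oplus\{i:A_i\}_{i\in I}$; from $P_i\vdash\Gamma,x:A_i$ for all $i\in I$ infer $x\triangleright\{i:P_i\}_{i\in I}\vdash\Gamma,x:\&\{i:A_i\}_{i\in I}$; from $P\vdash\Gamma,x:A$ infer $\overline{x}.\mathtt{some};P\vdash\Gamma,x:\&A$; $\overline{x}.\mathtt{none}\vdash x:\&A$; from $P\vdash\&\Gamma,x:A$ infer $x.\mathtt{some}_{\mathrm{dom}(\Gamma)};P\vdash\&\Gamma,x:\oplus A$.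
   Formalization: The typing rule for branch is taken only for non-empty I: with I empty it would type a branch in any context, and then (νx)((0 | y▷{}) | x();0) ⊢ y:&{} while the congruent (νx)(0 | x();0) | y▷{} is not typable. *)

theory Defs
  imports "HOL-Library.Finite_Map"
begin

type_synonym name = nat
type_synonym label = string

section \<open>Processes\<close>

(* Processes are raw terms; alpha-equivalence is part of structural congruence.
   Bound names: x in Conn x P Q (scope P and Q), y in Out x y P Q (scope P only),
   y in In x y P (scope P).  Identifying [x <-> y] with [y <-> x], and the monoid
   laws, are also left to structural congruence. *)
datatype proc =
    Inact                                ("\<^bold>0")
  | Fwd name name
  | Conn name proc proc
  | Choice proc proc                     (infixr "\<boxplus>" 65)
  | Out name name proc proc
  | In name name proc
  | Sel name label proc
  | Branch name "(label, proc) fmap"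
  | Close name
  | Wait name proc
  | Expect name "name fset" proc
  | Avail name proc
  | Unavail name
  | Par proc proc                        (infixr "\<parallel>" 66)

primrec fn :: "proc \<Rightarrow> name set" where
  "fn \<^bold>0 = {}"
| "fn (Fwd x y) = {x, y}"
| "fn (Conn x P Q) = (fn P \<union> fn Q) - {x}"
| "fn (P \<boxplus> Q) = fn P \<union> fn Q"
| "fn (Out x y P Q) = {x} \<union> (fn P - {y}) \<union> fn Q"
| "fn (In x y P) = {x} \<union> (fn P - {y})"
| "fn (Sel x l P) = {x} \<union> fn P"
| "fn (Branch x Ps) = {x} \<union> \<Union> (fmran' (fmmap fn Ps))"
| "fn (Close x) = {x}"
| "fn (Wait x P) = {x} \<union> fn P"
| "fn (Expect x W P) = {x} \<union> fset W \<union> fn P"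
| "fn (Avail x P) = {x} \<union> fn P"
| "fn (Unavail x) = {x}"
| "fn (P \<parallel> Q) = fn P \<union> fn Q"

definition avoid :: "name \<Rightarrow> name set \<Rightarrow> name" where
  "avoid y A = (if y \<notin> A then y else (LEAST z. z \<notin> A))"

(* Simultaneous capture-avoiding substitution of names for free names: a binder is
   kept when it captures nothing, and is replaced by a fresh name otherwise. *)
primrec ren :: "proc \<Rightarrow> (name \<Rightarrow> name) \<Rightarrow> proc" where
  "ren \<^bold>0 s = \<^bold>0"
| "ren (Fwd x y) s = Fwd (s x) (s y)"
| "ren (Conn x P Q) s =
     (let x' = avoid x (s ` ((fn P \<union> fn Q) - {x}))
      in Conn x' (ren P (s(x := x'))) (ren Q (s(x := x'))))"
| "ren (P \<boxplus> Q) s = ren P s \<boxplus> ren Q s"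
| "ren (Out x y P Q) s =
     (let y' = avoid y (s ` (fn P - {y}))
      in Out (s x) y' (ren P (s(y := y'))) (ren Q s))"
| "ren (In x y P) s =
     (let y' = avoid y (s ` (fn P - {y}))
      in In (s x) y' (ren P (s(y := y'))))"
| "ren (Sel x l P) s = Sel (s x) l (ren P s)"
| "ren (Branch x Ps) s = Branch (s x) (fmmap (\<lambda>r. r s) (fmmap ren Ps))"
| "ren (Close x) s = Close (s x)"
| "ren (Wait x P) s = Wait (s x) (ren P s)"
| "ren (Expect x W P) s = Expect (s x) (s |`| W) (ren P s)"
| "ren (Avail x P) s = Avail (s x) (ren P s)"
| "ren (Unavail x) s = Unavail (s x)"
| "ren (P \<parallel> Q) s = ren P s \<parallel> ren Q s"

(* P\<lbrace>y/z\<rbrace> replaces the free occurrences of z by y. *)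
definition subst :: "proc \<Rightarrow> name \<Rightarrow> name \<Rightarrow> proc" ("_\<lbrace>_'/_\<rbrace>" [1000, 0, 0] 1000) where
  "P\<lbrace>y/z\<rbrace> = ren P (id(z := y))"

(* The choice among a non-empty list of processes; every use below is on a
   non-empty list.  Other bracketings and orders are structurally congruent. *)
fun choice :: "proc list \<Rightarrow> proc" where
  "choice [] = \<^bold>0"
| "choice [P] = P"
| "choice (P # Q # Ps) = P \<boxplus> choice (Q # Ps)"

abbreviation bigchoice :: "nat \<Rightarrow> (nat \<Rightarrow> proc) \<Rightarrow> proc" where
  "bigchoice m F \<equiv> choice (map F [0..<m])"

syntax "_bigchoice" :: "pttrn \<Rightarrow> nat \<Rightarrow> proc \<Rightarrow> proc" ("(3\<boxplus>_<_./ _)" [0, 51, 67] 67)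
translations "\<boxplus>i<m. P" \<rightleftharpoons> "CONST bigchoice m (\<lambda>i. P)"

fun parallel :: "proc list \<Rightarrow> proc" where
  "parallel [] = \<^bold>0"
| "parallel [P] = P"
| "parallel (P # Q # Ps) = P \<parallel> parallel (Q # Ps)"

section \<open>Structural congruence\<close>

inductive congruence_closure :: "(proc \<Rightarrow> proc \<Rightarrow> bool) \<Rightarrow> proc \<Rightarrow> proc \<Rightarrow> bool"
  for R :: "proc \<Rightarrow> proc \<Rightarrow> bool" where
  base: "R P Q \<Longrightarrow> congruence_closure R P Q"
| refl: "congruence_closure R P P"
| sym: "congruence_closure R P Q \<Longrightarrow> congruence_closure R Q P"
| trans: "congruence_closure R P Q \<Longrightarrow> congruence_closure R Q Q' \<Longrightarrow> congruence_closure R P Q'"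
| Conn: "congruence_closure R P P' \<Longrightarrow> congruence_closure R Q Q' \<Longrightarrow>
    congruence_closure R (Conn x P Q) (Conn x P' Q')"
| Choice: "congruence_closure R P P' \<Longrightarrow> congruence_closure R Q Q' \<Longrightarrow>
    congruence_closure R (P \<boxplus> Q) (P' \<boxplus> Q')"
| Out: "congruence_closure R P P' \<Longrightarrow> congruence_closure R Q Q' \<Longrightarrow>
    congruence_closure R (Out x y P Q) (Out x y P' Q')"
| In: "congruence_closure R P P' \<Longrightarrow> congruence_closure R (In x y P) (In x y P')"
| Sel: "congruence_closure R P P' \<Longrightarrow> congruence_closure R (Sel x l P) (Sel x l P')"
| Branch: "fmdom Ps = fmdom Ps' \<Longrightarrow>
    (\<And>l P P'. fmlookup Ps l = Some P \<Longrightarrow> fmlookup Ps' l = Some P' \<Longrightarrow> congruence_closure R P P') \<Longrightarrow>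
    congruence_closure R (Branch x Ps) (Branch x Ps')"
| Wait: "congruence_closure R P P' \<Longrightarrow> congruence_closure R (Wait x P) (Wait x P')"
| Expect: "congruence_closure R P P' \<Longrightarrow> congruence_closure R (Expect x W P) (Expect x W P')"
| Avail: "congruence_closure R P P' \<Longrightarrow> congruence_closure R (Avail x P) (Avail x P')"
| Par: "congruence_closure R P P' \<Longrightarrow> congruence_closure R Q Q' \<Longrightarrow>
    congruence_closure R (P \<parallel> Q) (P' \<parallel> Q')"

inductive alpha_ax :: "proc \<Rightarrow> proc \<Rightarrow> bool" where
  "z \<notin> fn P \<union> fn Q \<Longrightarrow> alpha_ax (Conn x P Q) (Conn z (P\<lbrace>z/x\<rbrace>) (Q\<lbrace>z/x\<rbrace>))"
| "z \<notin> fn P \<Longrightarrow> alpha_ax (Out x y P Q) (Out x z (P\<lbrace>z/y\<rbrace>) Q)"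
| "z \<notin> fn P \<Longrightarrow> alpha_ax (In x y P) (In x z (P\<lbrace>z/y\<rbrace>))"

definition alpha_equiv :: "proc \<Rightarrow> proc \<Rightarrow> bool" where
  "alpha_equiv = congruence_closure alpha_ax"

inductive struct_ax :: "proc \<Rightarrow> proc \<Rightarrow> bool" where
  "alpha_equiv P P' \<Longrightarrow> struct_ax P P'"
| "struct_ax (Fwd x y) (Fwd y x)"
| "struct_ax (P \<parallel> \<^bold>0) P"
| "struct_ax ((P \<parallel> Q) \<parallel> R) (P \<parallel> (Q \<parallel> R))"
| "struct_ax (P \<parallel> Q) (Q \<parallel> P)"
| "struct_ax (Conn x P Q) (Conn x Q P)"
| "struct_ax (P \<boxplus> P) P"
| "struct_ax (P \<boxplus> Q) (Q \<boxplus> P)"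
| "struct_ax ((P \<boxplus> Q) \<boxplus> R) (P \<boxplus> (Q \<boxplus> R))"
| "x \<notin> fn Q \<Longrightarrow> struct_ax (Conn x (P \<parallel> Q) R) (Conn x P R \<parallel> Q)"
| "x \<noteq> y \<Longrightarrow> x \<notin> fn Q \<Longrightarrow> y \<notin> fn R \<Longrightarrow>
    struct_ax (Conn x (Conn y P Q) R) (Conn y (Conn x P R) Q)"

definition struct_cong :: "proc \<Rightarrow> proc \<Rightarrow> bool" (infix "\<equiv>\<^sub>s" 50) where
  "P \<equiv>\<^sub>s Q \<longleftrightarrow> congruence_closure struct_ax P Q"

section \<open>Contexts, prefixes and precongruence\<close>

datatype ctx =
    Hole
  | CPar ctx proc
  | CConn name ctx proc
  | CChoice ctx proc

primrec fill :: "ctx \<Rightarrow> proc \<Rightarrow> proc" ("_\<langle>_\<rangle>" [1000, 0] 1000) where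
  "Hole\<langle>A\<rangle> = A"
| "(CPar N P)\<langle>A\<rangle> = N\<langle>A\<rangle> \<parallel> P"
| "(CConn x N P)\<langle>A\<rangle> = Conn x (N\<langle>A\<rangle>) P"
| "(CChoice N P)\<langle>A\<rangle> = N\<langle>A\<rangle> \<boxplus> P"

primrec dctx :: "ctx \<Rightarrow> bool" where
  "dctx Hole \<longleftrightarrow> True"
| "dctx (CPar N P) \<longleftrightarrow> dctx N"
| "dctx (CConn x N P) \<longleftrightarrow> dctx N"
| "dctx (CChoice N P) \<longleftrightarrow> False"

(* The names that a context captures at its hole. *)
primrec captured :: "ctx \<Rightarrow> name set" where
  "captured Hole = {}"
| "captured (CPar N P) = captured N"
| "captured (CConn x N P) = insert x (captured N)"
| "captured (CChoice N P) = captured N"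

datatype pfx =
    POut name name
  | PIn name name
  | PSel name label
  | PBranch name
  | PClose name
  | PWait name
  | PAvail name
  | PUnavail name
  | PExpect name "name fset"
  | PFwd name name

primrec sub :: "pfx \<Rightarrow> name set" where
  "sub (POut x y) = {x}"
| "sub (PIn x y) = {x}"
| "sub (PSel x l) = {x}"
| "sub (PBranch x) = {x}"
| "sub (PClose x) = {x}"
| "sub (PWait x) = {x}"
| "sub (PAvail x) = {x}"
| "sub (PUnavail x) = {x}"
| "sub (PExpect x W) = {x}"
| "sub (PFwd x y) = {x, y}"

(* prefix_of A = Some a says that A is a prefixed process a;P. *)
fun prefix_of :: "proc \<Rightarrow> pfx option" where
  "prefix_of (Fwd x y) = Some (PFwd x y)"
| "prefix_of (Out x y P Q) = Some (POut x y)"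
| "prefix_of (In x y P) = Some (PIn x y)"
| "prefix_of (Sel x l P) = Some (PSel x l)"
| "prefix_of (Branch x Ps) = Some (PBranch x)"
| "prefix_of (Close x) = Some (PClose x)"
| "prefix_of (Wait x P) = Some (PWait x)"
| "prefix_of (Expect x W P) = Some (PExpect x W)"
| "prefix_of (Avail x P) = Some (PAvail x)"
| "prefix_of (Unavail x) = Some (PUnavail x)"
| "prefix_of _ = None"

inductive pfx_rel :: "pfx \<Rightarrow> pfx \<Rightarrow> bool" (infix "\<bowtie>" 50) where
  "POut x y \<bowtie> POut x z"
| "PIn x y \<bowtie> PIn x z"
| "a \<bowtie> a"

(* A finite family indexed by I is written as a family over {..<m}; families that
   provide the summands of a choice on their own have m > 0, while the families of
   discarded summands may be empty.  The variable convention is made explicit: x must not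
   be captured by the contexts around its occurrences. *)
inductive precong :: "proc \<Rightarrow> name set \<Rightarrow> proc \<Rightarrow> bool" ("(_ \<succeq>\<^bsub>_\<^esub>/ _)" [51, 0, 51] 50) where
  precong_single:
  "0 < m \<Longrightarrow>
   (\<And>i. i < m \<Longrightarrow> dctx (C i) \<and> x \<notin> captured (C i) \<and>
      prefix_of (A i) = Some (a i) \<and> sub (a i) = {x}) \<Longrightarrow>
   (\<And>i i'. i < m \<Longrightarrow> i' < m \<Longrightarrow> a i \<bowtie> a i') \<Longrightarrow>
   (\<And>j. j < n \<Longrightarrow> dctx (D j) \<and> x \<notin> captured (D j) \<and>
      prefix_of (B j) = Some (b j) \<and> x \<in> fn (B j)) \<Longrightarrow>
   (\<And>i j. i < m \<Longrightarrow> j < n \<Longrightarrow> \<not> a i \<bowtie> b j) \<Longrightarrow>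
     (choice (map (\<lambda>i. (C i)\<langle>A i\<rangle>) [0..<m] @ map (\<lambda>j. (D j)\<langle>B j\<rangle>) [0..<n]))
     \<succeq>\<^bsub>{x}\<^esub> (\<boxplus>i<m. (C i)\<langle>A i\<rangle>)"
| precong_fwd:
  "0 < m \<Longrightarrow>
   (\<And>i. i < m \<Longrightarrow> dctx (C i) \<and> x \<notin> captured (C i)) \<Longrightarrow>
   (\<And>j. j < n \<Longrightarrow> dctx (D j) \<and> x \<notin> captured (D j) \<and> z j \<noteq> y) \<Longrightarrow>
   (\<And>k. k < l \<Longrightarrow> dctx (E k) \<and> x \<notin> captured (E k) \<and>
      prefix_of (A k) = Some (a k) \<and> x \<in> fn (A k) \<and> (\<forall>u. \<not> a k \<bowtie> PFwd x u)) \<Longrightarrow>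
     (choice (map (\<lambda>i. (C i)\<langle>Fwd x y\<rangle>) [0..<m] @ map (\<lambda>j. (D j)\<langle>Fwd x (z j)\<rangle>) [0..<n]
        @ map (\<lambda>k. (E k)\<langle>A k\<rangle>) [0..<l]))
     \<succeq>\<^bsub>{x, y}\<^esub> (\<boxplus>i<m. (C i)\<langle>Fwd x y\<rangle>)"

section \<open>Reduction\<close>

(* The premises on fn and captured spell out the variable convention for the
   displayed redexes: x is the name bound by the outer connection, w is fresh, and no
   process is moved under a binder that captures one of its free names.  As reduction is
   closed under structural congruence, hence under alpha-equivalence, they can be met by
   renaming bound names.  In red_Id, y may be captured by the context of its forwarder;
   it is then captured in the same way after the substitution. *)
inductive reduce :: "proc \<Rightarrow> name set \<Rightarrow> proc \<Rightarrow> bool" ("(_ \<leadsto>\<^bsub>_\<^esub>/ _)" [51, 0, 51] 50) where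
  red_Id:
  "0 < m \<Longrightarrow>
   (\<And>i. i < m \<Longrightarrow> dctx (C i) \<and> x \<notin> captured (C i) \<and> captured (C i) \<inter> fn Q = {}) \<Longrightarrow>
   Conn x (\<boxplus>i<m. (C i)\<langle>Fwd x y\<rangle>) Q \<leadsto>\<^bsub>{x, y}\<^esub> (\<boxplus>i<m. (C i)\<langle>Q\<lbrace>y/x\<rbrace>\<rangle>)"
| red_Comm:
  "0 < m \<Longrightarrow> 0 < n \<Longrightarrow>
   (\<And>i. i < m \<Longrightarrow> dctx (C i) \<and> x \<notin> captured (C i)) \<Longrightarrow>
   (\<And>j. j < n \<Longrightarrow> dctx (D j) \<and> x \<notin> captured (D j)) \<Longrightarrow>
   (\<And>i j. i < m \<Longrightarrow> j < n \<Longrightarrow> captured (C i) \<inter> fn ((D j)\<langle>In x z (R j)\<rangle>) = {}) \<Longrightarrow>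
   w \<noteq> x \<Longrightarrow>
   (\<And>i. i < m \<Longrightarrow> w \<notin> fn (P i)) \<Longrightarrow>
   (\<And>j. j < n \<Longrightarrow> w \<notin> fn (R j) \<union> fn ((D j)\<langle>In x z (R j)\<rangle>) \<union> captured (D j)) \<Longrightarrow>
   Conn x (\<boxplus>i<m. (C i)\<langle>Out x (y i) (P i) (Q i)\<rangle>) (\<boxplus>j<n. (D j)\<langle>In x z (R j)\<rangle>)
     \<leadsto>\<^bsub>{x}\<^esub> (\<boxplus>i<m. (C i)\<langle>Conn x (Q i)
        (Conn w ((P i)\<lbrace>w/y i\<rbrace>) (\<boxplus>j<n. (D j)\<langle>(R j)\<lbrace>w/z\<rbrace>\<rangle>))\<rangle>)"
| red_Sel:
  "0 < m \<Longrightarrow> 0 < n \<Longrightarrow>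
   (\<And>i. i < m \<Longrightarrow> dctx (C i) \<and> x \<notin> captured (C i)) \<Longrightarrow>
   (\<And>j. j < n \<Longrightarrow> dctx (D j) \<and> x \<notin> captured (D j)) \<Longrightarrow>
   (\<And>j. j < n \<Longrightarrow> fmdom (Qs j) = K \<and> fmlookup (Qs j) k' = Some (Q j)) \<Longrightarrow>
   Conn x (\<boxplus>i<m. (C i)\<langle>Sel x k' (P i)\<rangle>) (\<boxplus>j<n. (D j)\<langle>Branch x (Qs j)\<rangle>)
     \<leadsto>\<^bsub>{x}\<^esub> (Conn x (\<boxplus>i<m. (C i)\<langle>P i\<rangle>) (\<boxplus>j<n. (D j)\<langle>Q j\<rangle>))"
| red_Close:
  "0 < m \<Longrightarrow> 0 < n \<Longrightarrow>
   (\<And>i. i < m \<Longrightarrow> dctx (C i) \<and> x \<notin> captured (C i)) \<Longrightarrow>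
   (\<And>j. j < n \<Longrightarrow> dctx (D j) \<and> x \<notin> captured (D j)) \<Longrightarrow>
   Conn x (\<boxplus>i<m. (C i)\<langle>Close x\<rangle>) (\<boxplus>j<n. (D j)\<langle>Wait x (Q j)\<rangle>)
     \<leadsto>\<^bsub>{x}\<^esub> ((\<boxplus>i<m. (C i)\<langle>\<^bold>0\<rangle>) \<parallel> (\<boxplus>j<n. (D j)\<langle>Q j\<rangle>))"
| red_Some:
  "0 < m \<Longrightarrow> 0 < n \<Longrightarrow>
   (\<And>i. i < m \<Longrightarrow> dctx (C i) \<and> x \<notin> captured (C i)) \<Longrightarrow>
   (\<And>j. j < n \<Longrightarrow> dctx (D j) \<and> x \<notin> captured (D j)) \<Longrightarrow>
   Conn x (\<boxplus>i<m. (C i)\<langle>Avail x (P i)\<rangle>) (\<boxplus>j<n. (D j)\<langle>Expect x W (Q j)\<rangle>)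
     \<leadsto>\<^bsub>{x}\<^esub> (Conn x (\<boxplus>i<m. (C i)\<langle>P i\<rangle>) (\<boxplus>j<n. (D j)\<langle>Q j\<rangle>))"
| red_None:
  "0 < m \<Longrightarrow> 0 < n \<Longrightarrow>
   (\<And>i. i < m \<Longrightarrow> dctx (C i) \<and> x \<notin> captured (C i)) \<Longrightarrow>
   (\<And>j. j < n \<Longrightarrow> dctx (D j) \<and> x \<notin> captured (D j)) \<Longrightarrow>
   distinct ws \<Longrightarrow>
   Conn x (\<boxplus>i<m. (C i)\<langle>Unavail x\<rangle>) (\<boxplus>j<n. (D j)\<langle>Expect x (fset_of_list ws) (Q j)\<rangle>)
     \<leadsto>\<^bsub>{x}\<^esub> ((\<boxplus>i<m. (C i)\<langle>\<^bold>0\<rangle>) \<parallel> (\<boxplus>j<n. (D j)\<langle>parallel (map Unavail ws)\<rangle>))"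
| red_precong:
  "x \<in> S \<Longrightarrow> P \<succeq>\<^bsub>S\<^esub> P' \<Longrightarrow> Q \<succeq>\<^bsub>S\<^esub> Q' \<Longrightarrow> Conn x P' Q' \<leadsto>\<^bsub>S\<^esub> R \<Longrightarrow>
   Conn x P Q \<leadsto>\<^bsub>S\<^esub> R"
| red_nu_choice:
  "dctx C \<Longrightarrow> Conn x P (N\<langle>C\<langle>Q1\<rangle> \<boxplus> C\<langle>Q2\<rangle>\<rangle>) \<leadsto>\<^bsub>S\<^esub> R \<Longrightarrow>
   Conn x P (N\<langle>C\<langle>Q1 \<boxplus> Q2\<rangle>\<rangle>) \<leadsto>\<^bsub>S\<^esub> R"
| red_struct:
  "P \<equiv>\<^sub>s P' \<Longrightarrow> P' \<leadsto>\<^bsub>S\<^esub> Q' \<Longrightarrow> Q' \<equiv>\<^sub>s Q \<Longrightarrow> P \<leadsto>\<^bsub>S\<^esub> Q"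
| red_Conn: "P \<leadsto>\<^bsub>S\<^esub> P' \<Longrightarrow> Conn x P Q \<leadsto>\<^bsub>S\<^esub> Conn x P' Q"
| red_Par: "P \<leadsto>\<^bsub>S\<^esub> P' \<Longrightarrow> P \<parallel> Q \<leadsto>\<^bsub>S\<^esub> P' \<parallel> Q"
| red_Choice: "P \<leadsto>\<^bsub>S\<^esub> P' \<Longrightarrow> P \<boxplus> Q \<leadsto>\<^bsub>S\<^esub> P' \<boxplus> Q"

section \<open>Session types and typing\<close>

datatype ty =
    One
  | Bot
  | Tensor ty ty
  | Parr ty ty
  | Plus "(label, ty) fmap"
  | With "(label, ty) fmap"
  | Amp ty
  | OPlus ty

primrec dual :: "ty \<Rightarrow> ty" where
  "dual One = Bot"
| "dual Bot = One"
| "dual (Tensor A B) = Parr (dual A) (dual B)"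
| "dual (Parr A B) = Tensor (dual A) (dual B)"
| "dual (Plus As) = With (fmmap dual As)"
| "dual (With As) = Plus (fmmap dual As)"
| "dual (Amp A) = OPlus (dual A)"
| "dual (OPlus A) = Amp (dual A)"

type_synonym tctx = "(name, ty) fmap"

definition amp_ctx :: "tctx \<Rightarrow> bool" where
  "amp_ctx \<Gamma> \<longleftrightarrow> fmpred (\<lambda>_ A. \<exists>A'. A = Amp A') \<Gamma>"

abbreviation fresh_in :: "name \<Rightarrow> tctx \<Rightarrow> bool" (infix "\<sharp>" 50) where
  "x \<sharp> \<Gamma> \<equiv> x |\<notin>| fmdom \<Gamma>"

abbreviation disj :: "tctx \<Rightarrow> tctx \<Rightarrow> bool" where
  "disj \<Gamma> \<Delta> \<equiv> fmdom \<Gamma> |\<inter>| fmdom \<Delta> = {||}"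

(* The freshness and disjointness premises express that a typing context assigns
   distinct names; Gamma, x:A is fmupd x A Gamma.  The branch rule is restricted to
   non-empty sets of alternatives: without any alternative it would type a branch in
   an arbitrary context, mentioning names that are not free in the process, and
   typing would not be invariant under scope extrusion (which looks at free names only). *)
inductive typed :: "proc \<Rightarrow> tctx \<Rightarrow> bool" (infix "\<turnstile>" 50) where
  T_cut: "P \<turnstile> fmupd x A \<Gamma> \<Longrightarrow> Q \<turnstile> fmupd x (dual A) \<Delta> \<Longrightarrow>
    x \<sharp> \<Gamma> \<Longrightarrow> x \<sharp> \<Delta> \<Longrightarrow> disj \<Gamma> \<Delta> \<Longrightarrow> Conn x P Q \<turnstile> \<Gamma> ++\<^sub>f \<Delta>"
| T_mix: "P \<turnstile> \<Gamma> \<Longrightarrow> Q \<turnstile> \<Delta> \<Longrightarrow> disj \<Gamma> \<Delta> \<Longrightarrow> P \<parallel> Q \<turnstile> \<Gamma> ++\<^sub>f \<Delta>"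
| T_choice: "P \<turnstile> \<Gamma> \<Longrightarrow> Q \<turnstile> \<Gamma> \<Longrightarrow> P \<boxplus> Q \<turnstile> \<Gamma>"
| T_inact: "\<^bold>0 \<turnstile> fmempty"
| T_fwd: "x \<noteq> y \<Longrightarrow> Fwd x y \<turnstile> fmupd y (dual A) (fmupd x A fmempty)"
| T_close: "Close x \<turnstile> fmupd x One fmempty"
| T_wait: "P \<turnstile> \<Gamma> \<Longrightarrow> x \<sharp> \<Gamma> \<Longrightarrow> Wait x P \<turnstile> fmupd x Bot \<Gamma>"
| T_out: "P \<turnstile> fmupd y A \<Gamma> \<Longrightarrow> Q \<turnstile> fmupd x B \<Delta> \<Longrightarrow>
    y \<sharp> \<Gamma> \<Longrightarrow> x \<sharp> \<Gamma> \<Longrightarrow> x \<sharp> \<Delta> \<Longrightarrow> disj \<Gamma> \<Delta> \<Longrightarrow>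
    Out x y P Q \<turnstile> fmupd x (Tensor A B) (\<Gamma> ++\<^sub>f \<Delta>)"
| T_in: "P \<turnstile> fmupd x B (fmupd y A \<Gamma>) \<Longrightarrow> x \<noteq> y \<Longrightarrow> x \<sharp> \<Gamma> \<Longrightarrow> y \<sharp> \<Gamma> \<Longrightarrow>
    In x y P \<turnstile> fmupd x (Parr A B) \<Gamma>"
| T_sel: "P \<turnstile> fmupd x A \<Gamma> \<Longrightarrow> x \<sharp> \<Gamma> \<Longrightarrow> fmlookup As j = Some A \<Longrightarrow>
    Sel x j P \<turnstile> fmupd x (Plus As) \<Gamma>"
| T_branch: "fmdom Ps = fmdom As \<Longrightarrow> fmdom As \<noteq> {||} \<Longrightarrow> x \<sharp> \<Gamma> \<Longrightarrow>
    (\<And>i P A. fmlookup Ps i = Some P \<Longrightarrow> fmlookup As i = Some A \<Longrightarrow> P \<turnstile> fmupd x A \<Gamma>) \<Longrightarrow>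
    Branch x Ps \<turnstile> fmupd x (With As) \<Gamma>"
| T_avail: "P \<turnstile> fmupd x A \<Gamma> \<Longrightarrow> x \<sharp> \<Gamma> \<Longrightarrow> Avail x P \<turnstile> fmupd x (Amp A) \<Gamma>"
| T_unavail: "Unavail x \<turnstile> fmupd x (Amp A) fmempty"
| T_expect: "P \<turnstile> fmupd x A \<Gamma> \<Longrightarrow> x \<sharp> \<Gamma> \<Longrightarrow> amp_ctx \<Gamma> \<Longrightarrow>
    Expect x (fmdom \<Gamma>) P \<turnstile> fmupd x (OPlus A) \<Gamma>"

end

(* A derivable P |- Gamma has dom Gamma = fn P.  Typing can therefore be stated relative to a
   total assignment g of types to names, by recursion on P, with side conditions that speak about
   free names only (wt below; the context is g restricted to fn P).  In this form typing is
   invariant under renamings that are injective on the free names, hence under structural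
   congruence.  For reductions, replacing the process in the hole of a typed D-context keeps the
   types of the captured names, so each rule amounts to a local check at the redexes. *)

theory Submission
  imports Defs
begin

text \<open>The main obstacle is that cut types are hidden: every connection on the path to a redex
  has an existentially chosen type, and the same choices must serve before and after a step. They
  are therefore collected in one assignment \<open>h\<close> at the hole, fixed before the
  replacement is known. A replacement may change the free names, since Id and Comm move a whole
  process into the hole, so the names lost and gained are tracked explicitly. The summands of a
  typed choice have equal free names, hence loss and gain must be uniform over the summands: every
  redex loses its subject \<open>x\<close> and gains the same set \<open>Y\<close>. As
  \<open>x\<close> is captured by none of the contexts, all redexes on one side see the same type
  for it, which makes the local checks compatible with each other.\<close>

section \<open>Typing relative to a total assignment of types\<close>

text \<open>A context split becomes a condition on \<open>fn\<close>:
  \<open>fn P \<inter> fn Q = {x}\<close> says at once that the cut name occurs on both sides and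
  that the remaining contexts are disjoint. The \<open>Branch\<close> clause inspects the predicates
  in \<open>fmmap wt Ps\<close>, the shape that primitive recursion through \<open>fmap\<close>
  requires.\<close>

primrec wt :: "proc \<Rightarrow> (name \<Rightarrow> ty) \<Rightarrow> bool" where
  "wt \<^bold>0 g \<longleftrightarrow> True"
| "wt (Fwd x y) g \<longleftrightarrow> x \<noteq> y \<and> g y = dual (g x)"
| "wt (Conn x P Q) g \<longleftrightarrow> fn P \<inter> fn Q = {x} \<and> (\<exists>A. wt P (g(x := A)) \<and> wt Q (g(x := dual A)))"
| "wt (P \<boxplus> Q) g \<longleftrightarrow> fn P = fn Q \<and> wt P g \<and> wt Q g"
| "wt (Out x y P Q) g \<longleftrightarrow> y \<in> fn P \<and> x \<in> fn Q \<and> (fn P - {y}) \<inter> fn Q = {} \<and>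
     (\<exists>A B. g x = Tensor A B \<and> wt P (g(y := A)) \<and> wt Q (g(x := B)))"
| "wt (In x y P) g \<longleftrightarrow> x \<noteq> y \<and> x \<in> fn P \<and> y \<in> fn P \<and>
     (\<exists>A B. g x = Parr A B \<and> wt P (g(x := B, y := A)))"
| "wt (Sel x l P) g \<longleftrightarrow> x \<in> fn P \<and>
     (\<exists>As A. g x = Plus As \<and> fmlookup As l = Some A \<and> wt P (g(x := A)))"
| "wt (Branch x Ps) g \<longleftrightarrow> (\<exists>As. g x = With As \<and> fmdom Ps = fmdom As \<and> fmdom As \<noteq> {||} \<and>
     (\<forall>i P. fmlookup Ps i = Some P \<longrightarrow> fn P = fn (Branch x Ps)) \<and>
     (\<forall>i r A. fmlookup (fmmap wt Ps) i = Some r \<longrightarrow> fmlookup As i = Some A \<longrightarrow> r (g(x := A))))"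
| "wt (Close x) g \<longleftrightarrow> g x = One"
| "wt (Wait x P) g \<longleftrightarrow> x \<notin> fn P \<and> g x = Bot \<and> wt P g"
| "wt (Expect x W P) g \<longleftrightarrow> x \<in> fn P \<and> fset W = fn P - {x} \<and> (\<forall>w\<in>fset W. \<exists>B. g w = Amp B) \<and>
     (\<exists>A. g x = OPlus A \<and> wt P (g(x := A)))"
| "wt (Avail x P) g \<longleftrightarrow> x \<in> fn P \<and> (\<exists>A. g x = Amp A \<and> wt P (g(x := A)))"
| "wt (Unavail x) g \<longleftrightarrow> (\<exists>A. g x = Amp A)"
| "wt (P \<parallel> Q) g \<longleftrightarrow> fn P \<inter> fn Q = {} \<and> wt P g \<and> wt Q g"

section \<open>Free names of branches, and dependence of \<open>wt\<close> on free names
  only\<close>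

lemma fn_Branch: "z \<in> fn (Branch x Ps) \<longleftrightarrow> z = x \<or> (\<exists>l P. fmlookup Ps l = Some P \<and> z \<in> fn P)"
  by (auto simp: fmlookup_ran'_iff) (metis fmran'I)

declare fn.simps(8) [simp del]

lemma fn_Branch_eqI:
  assumes "fmdom Ps \<noteq> {||}" "x \<in> F" "\<And>l P. fmlookup Ps l = Some P \<Longrightarrow> fn P = F"
  shows "fn (Branch x Ps) = F"
proof -
  obtain l P where "fmlookup Ps l = Some P"
    using assms(1) by (metis fmempty_lookup fmdom_empty fmap_ext option.exhaust)
  then show ?thesis
    using assms(2,3) by (auto simp: fn_Branch)
qed

lemma finite_fn [simp]: "finite (fn P)"
proof (induction P)
  case (Branch x Ps)
  have "fn (Branch x Ps) = insert x (\<Union> (fn ` fmran' Ps))"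
    by (auto 0 3 simp: fn_Branch fmlookup_ran'_iff intro: fmran'I)
  then show ?case
    using Branch by (simp add: fmran'_alt_def)
qed auto

lemma wt_BranchD:
  assumes "wt (Branch x Ps) g" "g x = With As" "fmlookup Ps l = Some P" "fmlookup As l = Some A"
  shows "fn P = fn (Branch x Ps) \<and> wt P (g(x := A))"
proof -
  have "fmlookup (fmmap wt Ps) l = Some (wt P)"
    using assms(3) by simp
  with assms show ?thesis
    unfolding wt.simps by (metis ty.inject(4))
qed

text \<open>Recursive calls override the assignment only at the subject or at a bound name, so
  agreement on free names is inherited by subprocesses. Values outside \<open>fn P\<close> are thus
  arbitrary, which justifies default values such as \<open>the None\<close> and updates at fresh
  names.\<close>

lemma wt_cong: "(\<And>z. z \<in> fn P \<Longrightarrow> g z = h z) \<Longrightarrow> wt P g \<longleftrightarrow> wt P h"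
proof (induction P arbitrary: g h)
  case (Conn x P Q)
  have "wt P (g(x := A)) = wt P (h(x := A))" "wt Q (g(x := A)) = wt Q (h(x := A))" for A
    by (rule Conn.IH; use Conn.prems in auto)+
  then show ?case by simp
next
  case (Out x y P Q)
  have "wt P (g(y := A)) = wt P (h(y := A))" "wt Q (g(x := A)) = wt Q (h(x := A))" for A
    by (rule Out.IH; use Out.prems in auto)+
  moreover have "g x = h x" using Out.prems by simp
  ultimately show ?case by simp
next
  case (In x y P)
  have "wt P (g(x := B, y := A)) = wt P (h(x := B, y := A))" for A B
    by (rule In.IH) (use In.prems in auto)
  moreover have "g x = h x" using In.prems by simp
  ultimately show ?case by simp
next
  case (Sel x l P)
  have "wt P (g(x := A)) = wt P (h(x := A))" for A
    by (rule Sel.IH) (use Sel.prems in auto)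
  moreover have "g x = h x" using Sel.prems by simp
  ultimately show ?case by simp
next
  case (Avail x P)
  have "wt P (g(x := A)) = wt P (h(x := A))" for A
    by (rule Avail.IH) (use Avail.prems in auto)
  moreover have "g x = h x" using Avail.prems by simp
  ultimately show ?case by simp
next
  case (Expect x W P)
  have "wt P (g(x := A)) = wt P (h(x := A))" for A
    by (rule Expect.IH) (use Expect.prems in auto)
  moreover have "g x = h x" "\<forall>w\<in>fset W. g w = h w" using Expect.prems by simp_all
  ultimately show ?case by simp
next
  case (Branch x Ps)
  have "wt P (g(x := A)) = wt P (h(x := A))" if "fmlookup Ps l = Some P" for l P A
    by (rule Branch.IH) (use Branch.prems that in \<open>auto simp: fn_Branch fmlookup_ran'_iff\<close>)
  moreover have "g x = h x" using Branch.prems by (simp add: fn_Branch)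
  ultimately show ?case by (auto 4 4)
next
  case (Choice P Q)
  have "wt P g = wt P h" "wt Q g = wt Q h"
    by (rule Choice.IH; use Choice.prems in auto)+
  then show ?case by simp
next
  case (Par P Q)
  have "wt P g = wt P h" "wt Q g = wt Q h"
    by (rule Par.IH; use Par.prems in auto)+
  then show ?case by simp
next
  case (Wait x P)
  have "wt P g = wt P h"
    by (rule Wait.IH) (use Wait.prems in auto)
  then show ?case using Wait.prems by simp
qed auto

lemma wt_upd [simp]: "x \<notin> fn P \<Longrightarrow> wt P (g(x := A)) \<longleftrightarrow> wt P g"
  by (rule wt_cong) auto

section \<open>Agreement with the typing judgement\<close>

text \<open>The sorted list serves only to obtain a finite map; for infinite \<open>F\<close> it is
  empty, hence the finiteness assumptions on \<open>F\<close> below.\<close>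

definition ctx_on :: "name set \<Rightarrow> (name \<Rightarrow> ty) \<Rightarrow> tctx" where
  "ctx_on F g = fmap_of_list (map (\<lambda>z. (z, g z)) (sorted_list_of_set F))"

lemma lookup_ctx_on [simp]:
  "finite F \<Longrightarrow> fmlookup (ctx_on F g) z = (if z \<in> F then Some (g z) else None)"
  by (simp add: ctx_on_def fmlookup_of_list map_of_map_restrict restrict_map_def)

lemma fmdom_ctx_on [simp]: "finite F \<Longrightarrow> z |\<in>| fmdom (ctx_on F g) \<longleftrightarrow> z \<in> F"
  by (simp add: fmlookup_dom_iff)

lemma fset_fmdom_ctx_on [simp]: "finite F \<Longrightarrow> fset (fmdom (ctx_on F g)) = F"
  using fmdom_ctx_on by blast

lemma fmdom_ctx_on_disj: "finite F \<Longrightarrow> finite G \<Longrightarrow> F \<inter> G = {} \<Longrightarrow> disj (ctx_on F g) (ctx_on G h)"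
  by auto

lemma ctx_on_upd:
  "finite F \<Longrightarrow> x \<in> F \<Longrightarrow> ctx_on F (g(x := A)) = fmupd x A (ctx_on (F - {x}) g)"
  by (rule fmap_ext) auto

lemma typed_ctx_on_upd:
  "P \<turnstile> ctx_on (fn P) (g(x := A)) \<Longrightarrow> x \<in> fn P \<Longrightarrow> P \<turnstile> fmupd x A (ctx_on (fn P - {x}) g)"
  by (simp only: ctx_on_upd finite_fn)

lemma ctx_on_upd':
  "finite F \<Longrightarrow> x \<in> F \<Longrightarrow> g x = A \<Longrightarrow> ctx_on F g = fmupd x A (ctx_on (F - {x}) g)"
  by (rule fmap_ext) auto

lemma ctx_on_Un:
  "finite F \<Longrightarrow> finite G \<Longrightarrow> ctx_on (F \<union> G) g = ctx_on F g ++\<^sub>f ctx_on G g"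
  by (rule fmap_ext) auto

text \<open>Each induction hypothesis concerns the assignment read off a premise's context. On the
  free names of the subprocess it agrees with the one read off the conclusion, after the updates
  made by \<open>wt\<close>, so \<open>wt_cong\<close> transports it.\<close>

lemma typed_imp_wt: "P \<turnstile> \<Gamma> \<Longrightarrow> fn P = fset (fmdom \<Gamma>) \<and> wt P (\<lambda>z. the (fmlookup \<Gamma> z))"
proof (induction rule: typed.induct)
  case (T_cut P x A \<Gamma> Q \<Delta>)
  let ?g = "\<lambda>z. the (fmlookup (\<Gamma> ++\<^sub>f \<Delta>) z)"
  have P: "fn P = insert x (fset (fmdom \<Gamma>))" and Q: "fn Q = insert x (fset (fmdom \<Delta>))"
    using T_cut.IH by auto
  \<comment> \<open>In \<open>\<Gamma> ++\<^sub>f \<Delta>\<close> the right operand takes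
    precedence, so reading the types of \<open>\<Gamma>\<close> off the sum depends on
    disjointness.\<close>
  have d: "z \<notin> fset (fmdom \<Gamma>)" if "z \<in> fset (fmdom \<Delta>)" for z
    using T_cut.hyps(5) that by auto
  have "wt P (?g(x := A))"
    by (rule wt_cong[THEN iffD1, rotated], rule conjunct2[OF T_cut.IH(1)])
      (use d in \<open>auto simp: P\<close>)
  moreover have "wt Q (?g(x := dual A))"
    by (rule wt_cong[THEN iffD1, rotated], rule conjunct2[OF T_cut.IH(2)])
      (use d in \<open>auto simp: Q\<close>)
  ultimately show ?case
    using P Q T_cut.hyps d by auto
next
  case (T_mix P \<Gamma> Q \<Delta>)
  let ?g = "\<lambda>z. the (fmlookup (\<Gamma> ++\<^sub>f \<Delta>) z)"
  have d: "z \<notin> fset (fmdom \<Gamma>)" if "z \<in> fset (fmdom \<Delta>)" for z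
    using T_mix.hyps(3) that by auto
  have "wt P ?g"
    by (rule wt_cong[THEN iffD1, rotated], rule conjunct2[OF T_mix.IH(1)])
      (use d T_mix.IH in auto)
  moreover have "wt Q ?g"
    by (rule wt_cong[THEN iffD1, rotated], rule conjunct2[OF T_mix.IH(2)])
      (use d T_mix.IH in auto)
  ultimately show ?case
    using T_mix.IH d by auto
next
  case (T_wait P \<Gamma> x)
  then have "wt P ((\<lambda>z. the (fmlookup \<Gamma> z))(x := Bot))"
    by simp
  also have "(\<lambda>z. the (fmlookup \<Gamma> z))(x := Bot) = (\<lambda>z. the (fmlookup (fmupd x Bot \<Gamma>) z))"
    by auto
  finally show ?case
    using T_wait by simp
next
  case (T_out P y A \<Gamma> Q x B \<Delta>)
  let ?g = "\<lambda>z. the (fmlookup (fmupd x (Tensor A B) (\<Gamma> ++\<^sub>f \<Delta>)) z)"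
  have P: "fn P = insert y (fset (fmdom \<Gamma>))" and Q: "fn Q = insert x (fset (fmdom \<Delta>))"
    using T_out.IH by auto
  have d: "z \<notin> fset (fmdom \<Gamma>)" if "z \<in> fset (fmdom \<Delta>)" for z
    using T_out.hyps(6) that by auto
  have "wt P (?g(y := A))"
    by (rule wt_cong[THEN iffD1, rotated], rule conjunct2[OF T_out.IH(1)])
      (use d T_out.hyps in \<open>auto simp: P\<close>)
  moreover have "wt Q (?g(x := B))"
    by (rule wt_cong[THEN iffD1, rotated], rule conjunct2[OF T_out.IH(2)])
      (use d T_out.hyps in \<open>auto simp: Q\<close>)
  ultimately show ?case
    using P Q T_out.hyps d by auto
next
  case (T_in P x B y A \<Gamma>)
  let ?g = "\<lambda>z. the (fmlookup (fmupd x (Parr A B) \<Gamma>) z)"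
  have "wt P (?g(x := B, y := A))"
    by (rule wt_cong[THEN iffD1, rotated], rule conjunct2[OF T_in.IH])
      (use T_in.hyps in auto)
  then show ?case
    using T_in by auto
next
  case (T_sel P x A \<Gamma> As j)
  let ?g = "\<lambda>z. the (fmlookup (fmupd x (Plus As) \<Gamma>) z)"
  have "wt P (?g(x := A))"
    by (rule wt_cong[THEN iffD1, rotated], rule conjunct2[OF T_sel.IH])
      (use T_sel.hyps in auto)
  then show ?case
    using T_sel by auto
next
  case (T_branch Ps As x \<Gamma>)
  let ?g = "\<lambda>z. the (fmlookup (fmupd x (With As) \<Gamma>) z)"
  have P: "fn P = insert x (fset (fmdom \<Gamma>)) \<and> wt P (?g(x := A))"
    if "fmlookup Ps i = Some P" "fmlookup As i = Some A" for i P A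
  proof -
    note IH = T_branch.IH[OF that]
    have "wt P (?g(x := A))"
      by (rule wt_cong[THEN iffD1, rotated], rule conjunct2[OF IH]) auto
    then show ?thesis
      using IH by simp
  qed
  have F: "fn P = insert x (fset (fmdom \<Gamma>))" if "fmlookup Ps i = Some P" for i P
  proof -
    have "i |\<in>| fmdom As"
      using that T_branch.hyps(1) by (metis fmdomI)
    then obtain A where "fmlookup As i = Some A" by auto
    with P that show ?thesis by blast
  qed
  \<comment> \<open>The non-emptiness premise of the branch rule enters here: without alternatives
    only \<open>x\<close> would be free in the process, whatever names \<open>\<Gamma>\<close>
    contains.\<close>
  have fB: "fn (Branch x Ps) = insert x (fset (fmdom \<Gamma>))"
    by (rule fn_Branch_eqI) (use T_branch.hyps F in auto)
  show ?case
    using T_branch.hyps P F by (auto simp: fB)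
next
  case (T_avail P x A \<Gamma>)
  let ?g = "\<lambda>z. the (fmlookup (fmupd x (Amp A) \<Gamma>) z)"
  have "wt P (?g(x := A))"
    by (rule wt_cong[THEN iffD1, rotated], rule conjunct2[OF T_avail.IH])
      (use T_avail.hyps in auto)
  then show ?case
    using T_avail by auto
next
  case (T_expect P x A \<Gamma>)
  let ?g = "\<lambda>z. the (fmlookup (fmupd x (OPlus A) \<Gamma>) z)"
  have "wt P (?g(x := A))"
    by (rule wt_cong[THEN iffD1, rotated], rule conjunct2[OF T_expect.IH])
      (use T_expect.hyps in auto)
  moreover have "\<exists>B. ?g w = Amp B" if "w \<in> fset (fmdom \<Gamma>)" for w
    using that T_expect.hyps by (auto simp: amp_ctx_def fmpred_iff fmlookup_dom_iff)
  ultimately show ?case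
    using T_expect by auto
qed auto

text \<open>All contexts of the derivation are restrictions of \<open>g\<close>, updated where the
  rule asks for it, so splitting a context amounts to splitting a set of free names.\<close>

lemma wt_imp_typed: "wt P g \<Longrightarrow> P \<turnstile> ctx_on (fn P) g"
proof (induction P arbitrary: g)
  case Inact
  have "ctx_on (fn \<^bold>0) g = fmempty" by (rule fmap_ext) simp
  then show ?case by (simp add: T_inact del: fn.simps)
next
  case (Fwd x y)
  have "ctx_on (fn (Fwd x y)) g = fmupd y (dual (g x)) (fmupd x (g x) fmempty)"
    by (rule fmap_ext) (use Fwd in auto)
  then show ?case using Fwd by (simp add: T_fwd del: fn.simps)
next
  case (Conn x P Q)
  then obtain A where w: "fn P \<inter> fn Q = {x}" "wt P (g(x := A))" "wt Q (g(x := dual A))"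
    by auto
  then have x: "x \<in> fn P" "x \<in> fn Q" by auto
  have "P \<turnstile> fmupd x A (ctx_on (fn P - {x}) g)" "Q \<turnstile> fmupd x (dual A) (ctx_on (fn Q - {x}) g)"
    by (intro typed_ctx_on_upd Conn.IH w x)+
  then have "Conn x P Q \<turnstile> ctx_on (fn P - {x}) g ++\<^sub>f ctx_on (fn Q - {x}) g"
    using w(1) by (intro T_cut[where A = A] fmdom_ctx_on_disj) auto
  also have "ctx_on (fn P - {x}) g ++\<^sub>f ctx_on (fn Q - {x}) g = ctx_on (fn (Conn x P Q)) g"
    by (simp add: ctx_on_Un[symmetric] Un_Diff)
  finally show ?case .
next
  case (Choice P Q)
  then show ?case by (auto intro: T_choice)
next
  case (Out x y P Q)
  then obtain A B where w: "y \<in> fn P" "x \<in> fn Q" "(fn P - {y}) \<inter> fn Q = {}"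
    "g x = Tensor A B" "wt P (g(y := A))" "wt Q (g(x := B))"
    by auto
  have P: "P \<turnstile> fmupd y A (ctx_on (fn P - {y}) g)" and Q: "Q \<turnstile> fmupd x B (ctx_on (fn Q - {x}) g)"
    by (intro typed_ctx_on_upd Out.IH w)+
  have "Out x y P Q \<turnstile> fmupd x (Tensor A B) (ctx_on (fn P - {y}) g ++\<^sub>f ctx_on (fn Q - {x}) g)"
    using w(1-4) by (intro T_out fmdom_ctx_on_disj P Q) auto
  also have "fmupd x (Tensor A B) (ctx_on (fn P - {y}) g ++\<^sub>f ctx_on (fn Q - {x}) g) =
      ctx_on (fn (Out x y P Q)) g"
    by (rule fmap_ext) (use w in auto)
  finally show ?case .
next
  case (In x y P)
  then obtain A B where w: "x \<noteq> y" "x \<in> fn P" "y \<in> fn P"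
    "g x = Parr A B" "wt P (g(x := B, y := A))"
    by auto
  have "ctx_on (fn P) (g(x := B, y := A)) = fmupd x B (fmupd y A (ctx_on (fn P - {x, y}) g))"
    by (rule fmap_ext) (use w in auto)
  then have "P \<turnstile> fmupd x B (fmupd y A (ctx_on (fn P - {x, y}) g))"
    using In.IH[OF w(5)] by (simp only:)
  then have "In x y P \<turnstile> fmupd x (Parr A B) (ctx_on (fn P - {x, y}) g)"
    using w(1) by (rule T_in) auto
  also have "fmupd x (Parr A B) (ctx_on (fn P - {x, y}) g) = ctx_on (fn (In x y P)) g"
    by (rule fmap_ext) (use w in auto)
  finally show ?case .
next
  case (Sel x l P)
  then obtain As A where w: "x \<in> fn P" "g x = Plus As" "fmlookup As l = Some A" "wt P (g(x := A))"
    by auto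
  have "Sel x l P \<turnstile> fmupd x (Plus As) (ctx_on (fn P - {x}) g)"
    using w(1,3) by (intro T_sel[where A = A] typed_ctx_on_upd Sel.IH w(4)) auto
  then show ?case
    using w(1) by (simp only: fn.simps insert_absorb Un_insert_left Un_empty_left ctx_on_upd'[where g = g, OF finite_fn w(1,2)])
next
  case (Branch x Ps)
  then obtain As where w: "g x = With As" "fmdom Ps = fmdom As" "fmdom As \<noteq> {||}"
    "\<And>i P. fmlookup Ps i = Some P \<Longrightarrow> fn P = fn (Branch x Ps)"
    and wt: "\<And>i r A. fmlookup (fmmap wt Ps) i = Some r \<Longrightarrow> fmlookup As i = Some A \<Longrightarrow> r (g(x := A))"
    unfolding wt.simps by blast
  let ?F = "fn (Branch x Ps)"
  have x: "x \<in> ?F" by (simp add: fn_Branch)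
  have "Branch x Ps \<turnstile> fmupd x (With As) (ctx_on (?F - {x}) g)"
  proof (rule T_branch)
    fix i P A
    assume P: "fmlookup Ps i = Some P" "fmlookup As i = Some A"
    then have "P \<turnstile> ctx_on (fn P) (g(x := A))"
      using wt[OF _ P(2)] P(1) by (auto intro!: Branch.IH fmran'I)
    then show "P \<turnstile> fmupd x A (ctx_on (?F - {x}) g)"
      using w(4)[OF P(1)] x by (simp add: ctx_on_upd)
  qed (use w in auto)
  then show ?case
    by (simp only: ctx_on_upd'[where g = g, OF finite_fn x w(1)])
next
  case (Close x)
  have "ctx_on (fn (Close x)) g = fmupd x One fmempty"
    by (rule fmap_ext) (use Close in auto)
  then show ?case by (simp add: T_close del: fn.simps)
next
  case (Wait x P)
  have "Wait x P \<turnstile> fmupd x Bot (ctx_on (fn P) g)"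
    using Wait by (intro T_wait) auto
  also have "fmupd x Bot (ctx_on (fn P) g) = ctx_on (fn (Wait x P)) g"
    by (rule fmap_ext) (use Wait in auto)
  finally show ?case .
next
  case (Expect x W P)
  then obtain A where w: "x \<in> fn P" "fset W = fn P - {x}" "\<forall>w\<in>fset W. \<exists>B. g w = Amp B"
    "g x = OPlus A" "wt P (g(x := A))"
    by auto
  \<comment> \<open>The typing rule fixes the subscript as the domain of its context, so
    \<open>W\<close> has to be recognised as such a domain.\<close>
  have W: "fmdom (ctx_on (fn P - {x}) g) = W"
    using w(2) by (simp add: fset_inject[symmetric])
  have "Expect x (fmdom (ctx_on (fn P - {x}) g)) P \<turnstile> fmupd x (OPlus A) (ctx_on (fn P - {x}) g)"
    using w(1-3)
    by (intro T_expect typed_ctx_on_upd Expect.IH w(5)) (auto simp: amp_ctx_def fmpred_iff split: if_splits)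
  moreover have "fn (Expect x W P) = fn P"
    using w by auto
  ultimately show ?case
    by (simp only: W ctx_on_upd'[where g = g, OF finite_fn w(1,4)])
next
  case (Avail x P)
  then obtain A where w: "x \<in> fn P" "g x = Amp A" "wt P (g(x := A))"
    by auto
  have "Avail x P \<turnstile> fmupd x (Amp A) (ctx_on (fn P - {x}) g)"
    using w(1) by (intro T_avail typed_ctx_on_upd Avail.IH w(3)) auto
  then show ?case
    using w(1) by (simp only: fn.simps insert_absorb Un_insert_left Un_empty_left ctx_on_upd'[where g = g, OF finite_fn w(1,2)])
next
  case (Unavail x)
  then obtain A where "g x = Amp A" by auto
  then have "ctx_on (fn (Unavail x)) g = fmupd x (Amp A) fmempty"
    by (intro fmap_ext) auto
  then show ?case by (simp add: T_unavail del: fn.simps)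
next
  case (Par P Q)
  then show ?case
    by (auto simp: ctx_on_Un intro!: T_mix fmdom_ctx_on_disj)
qed

lemma typed_iff_wt: "P \<turnstile> \<Gamma> \<longleftrightarrow> fn P = fset (fmdom \<Gamma>) \<and> wt P (\<lambda>z. the (fmlookup \<Gamma> z))"
proof (intro iffI)
  assume *: "fn P = fset (fmdom \<Gamma>) \<and> wt P (\<lambda>z. the (fmlookup \<Gamma> z))"
  then have "P \<turnstile> ctx_on (fn P) (\<lambda>z. the (fmlookup \<Gamma> z))"
    using wt_imp_typed by blast
  moreover have "ctx_on (fn P) (\<lambda>z. the (fmlookup \<Gamma> z)) = \<Gamma>"
  proof (rule fmap_ext)
    fix z
    show "fmlookup (ctx_on (fn P) (\<lambda>z. the (fmlookup \<Gamma> z))) z = fmlookup \<Gamma> z"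
      using * by (cases "fmlookup \<Gamma> z") (simp_all add: fmdomI fmdom_notI)
  qed
  ultimately show "P \<turnstile> \<Gamma>" by simp
qed (rule typed_imp_wt)

section \<open>Renaming\<close>

lemma avoid_notin: "finite A \<Longrightarrow> avoid y A \<notin> A"
proof -
  assume "finite A"
  then have "\<exists>z. z \<notin> A" by (meson ex_new_if_finite infinite_UNIV_nat)
  then have "(LEAST z. z \<notin> A) \<notin> A" by (rule LeastI_ex)
  then show ?thesis by (simp add: avoid_def)
qed

text \<open>As \<open>x'\<close> is not the image of any other name, deleting it removes only what
  came from \<open>x\<close>. This is the effect of a renamed binder on free names.\<close>

lemma fun_upd_image_Diff: "x' \<notin> s ` (F - {x}) \<Longrightarrow> s(x := x') ` F - {x'} = s ` (F - {x})"
  by (auto simp: image_iff)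

lemma fn_ren [simp]: "fn (ren P s) = s ` fn P"
proof (induction P arbitrary: s)
  case (Conn x P Q)
  let ?x = "avoid x (s ` (fn P \<union> fn Q - {x}))"
  have "?x \<notin> s ` (fn P \<union> fn Q - {x})"
    by (rule avoid_notin) simp
  from fun_upd_image_Diff[OF this] show ?case
    by (simp only: ren.simps fn.simps Let_def Conn.IH image_Un[symmetric])
next
  case (Out x y P Q)
  have "avoid y (s ` (fn P - {y})) \<notin> s ` (fn P - {y})"
    by (rule avoid_notin) simp
  from fun_upd_image_Diff[OF this] show ?case
    by (simp add: Let_def Out.IH image_Un)
next
  case (In x y P)
  have "avoid y (s ` (fn P - {y})) \<notin> s ` (fn P - {y})"
    by (rule avoid_notin) simp
  from fun_upd_image_Diff[OF this] show ?case
    by (simp add: Let_def In.IH image_Un)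
next
  case (Branch x Ps)
  have "fn (ren P s) = s ` fn P" if "fmlookup Ps l = Some P" for P l
    by (rule Branch.IH) (use that in \<open>auto simp: fmlookup_ran'_iff\<close>)
  then have "z \<in> fn (ren (Branch x Ps) s) \<longleftrightarrow> z = s x \<or> (\<exists>l P. fmlookup Ps l = Some P \<and> z \<in> s ` fn P)" for z
    by (force simp: fn_Branch fmlookup_map)
  moreover have "z \<in> s ` fn (Branch x Ps) \<longleftrightarrow> z = s x \<or> (\<exists>l P. fmlookup Ps l = Some P \<and> z \<in> s ` fn P)" for z
    unfolding image_iff Bex_def fn_Branch by metis
  ultimately show ?case
    by blast
qed auto

lemma inj_on_fun_upd:
  "inj_on s (F - {x}) \<Longrightarrow> x' \<notin> s ` (F - {x}) \<Longrightarrow> inj_on (s(x := x')) F"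
  by (auto simp: inj_on_def)

lemma wt_comp_upd:
  "inj_on s (insert x (fn P)) \<Longrightarrow> wt P (g(s x := A) \<circ> s) = wt P ((g \<circ> s)(x := A))"
  by (rule wt_cong) (auto simp: inj_on_def)

text \<open>Injectivity keeps the linearity conditions, which compare sets of free names. It passes
  under binders because \<open>avoid\<close> picks a name outside the image of the other free
  names.\<close>

lemma wt_ren: "inj_on s (fn P) \<Longrightarrow> wt (ren P s) g \<longleftrightarrow> wt P (g \<circ> s)"
proof (induction P arbitrary: s g)
  case (Fwd x y)
  then show ?case by (auto simp: inj_on_def)
next
  case (Conn x P Q)
  let ?F = "fn P \<union> fn Q"
  define x' where "x' = avoid x (s ` (?F - {x}))"
  have x': "x' \<notin> s ` (?F - {x})"
    unfolding x'_def by (rule avoid_notin) simp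
  have inj: "inj_on (s(x := x')) ?F"
    using Conn.prems by (intro inj_on_fun_upd x') simp
  \<comment> \<open>Freshness of \<open>x'\<close>: no free name other than \<open>x\<close> is sent
    to it, so the update at \<open>x'\<close> is seen by \<open>x\<close> alone.\<close>
  have upd: "((g(x' := A)) \<circ> s(x := x')) z = ((g \<circ> s)(x := A)) z" if "z \<in> ?F" for z A
    using that x' by auto
  have "wt (ren P (s(x := x'))) (g(x' := A)) = wt P ((g \<circ> s)(x := A))" for A
    by (subst Conn.IH(1)[OF inj_on_subset[OF inj]], simp, rule wt_cong, rule upd) simp
  moreover have "wt (ren Q (s(x := x'))) (g(x' := A)) = wt Q ((g \<circ> s)(x := A))" for A
    by (subst Conn.IH(2)[OF inj_on_subset[OF inj]], simp, rule wt_cong, rule upd) simp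
  moreover have "s(x := x') ` fn P \<inter> s(x := x') ` fn Q = {x'} \<longleftrightarrow> fn P \<inter> fn Q = {x}"
  proof -
    \<comment> \<open>\<open>x\<close> is added to the domain because the equivalence must also hold
      when \<open>x\<close> is free in neither component.\<close>
    have inj': "inj_on (s(x := x')) (insert x ?F)"
      using Conn.prems x' by (intro inj_on_fun_upd) (auto simp: insert_Diff_if)
    have "s(x := x') ` fn P \<inter> s(x := x') ` fn Q = s(x := x') ` (fn P \<inter> fn Q)"
      by (rule inj_on_image_Int[OF inj, symmetric]) auto
    moreover have "s(x := x') ` (fn P \<inter> fn Q) = s(x := x') ` {x} \<longleftrightarrow> fn P \<inter> fn Q = {x}"
      by (rule inj_on_image_eq_iff[OF inj']) auto
    ultimately show ?thesis by simp
  qed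
  ultimately show ?case
    by (simp only: ren.simps Let_def x'_def[symmetric] wt.simps fn_ren)
next
  case (Choice P Q)
  have "s ` fn P = s ` fn Q \<longleftrightarrow> fn P = fn Q"
    by (rule inj_on_image_eq_iff[OF Choice.prems]) auto
  then show ?case
    using Choice by (simp add: inj_on_Un)
next
  case (Out x y P Q)
  define y' where "y' = avoid y (s ` (fn P - {y}))"
  have y': "y' \<notin> s ` (fn P - {y})"
    unfolding y'_def by (rule avoid_notin) simp
  have injF: "inj_on s (insert x ((fn P - {y}) \<union> fn Q))"
    using Out.prems by simp
  have inj: "inj_on (s(y := y')) (fn P)"
    by (intro inj_on_fun_upd y' inj_on_subset[OF injF]) auto
  have injQ: "inj_on s (fn Q)"
    by (rule inj_on_subset[OF injF]) auto
  have P: "wt (ren P (s(y := y'))) (g(y' := A)) = wt P ((g \<circ> s)(y := A))" for A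
    unfolding Out.IH(1)[OF inj] by (rule wt_cong) (use y' in auto)
  have Q: "wt (ren Q s) (g(s x := A)) = wt Q ((g \<circ> s)(x := A))" for A
    unfolding Out.IH(2)[OF injQ] by (rule wt_comp_upd) (rule inj_on_subset[OF injF], auto)
  have y: "y' \<in> s(y := y') ` fn P \<longleftrightarrow> y \<in> fn P"
    using y' by auto
  have x: "s x \<in> s ` fn Q \<longleftrightarrow> x \<in> fn Q"
    by (rule inj_on_image_mem_iff[OF injF]) auto
  have d: "(s(y := y') ` fn P - {y'}) \<inter> s ` fn Q = {} \<longleftrightarrow> (fn P - {y}) \<inter> fn Q = {}"
  proof -
    have "s ` (fn P - {y}) \<inter> s ` fn Q = s ` ((fn P - {y}) \<inter> fn Q)"
      by (rule inj_on_image_Int[OF injF, symmetric]) auto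
    then show ?thesis
      by (simp only: fun_upd_image_Diff[OF y'] image_is_empty)
  qed
  show ?case
    by (simp only: ren.simps Let_def y'_def[symmetric] wt.simps fn_ren P Q x y d comp_def)
next
  case (In x y P)
  define y' where "y' = avoid y (s ` (fn P - {y}))"
  have y': "y' \<notin> s ` (fn P - {y})"
    unfolding y'_def by (rule avoid_notin) simp
  have injF: "inj_on s (insert x (fn P - {y}))"
    using In.prems by simp
  have inj: "inj_on (s(y := y')) (fn P)"
    by (intro inj_on_fun_upd y' inj_on_subset[OF injF]) auto
  have y: "y' \<in> s(y := y') ` fn P \<longleftrightarrow> y \<in> fn P"
    using y' by auto
  have P: "wt (ren P (s(y := y'))) (g(s x := B, y' := A)) = wt P ((g \<circ> s)(x := B, y := A))"
    for A B
    unfolding In.IH[OF inj] by (rule wt_cong) (use y' injF in \<open>auto simp: inj_on_def\<close>)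
  \<comment> \<open>Only the conjunction is invariant: if \<open>x\<close> is not free in
    \<open>P\<close>, the chosen \<open>y'\<close> may happen to equal \<open>s x\<close> although
    \<open>x\<close> and \<open>y\<close> differ. Together the conditions say that \<open>x\<close>
    lies in \<open>fn P - {y}\<close>.\<close>
  have x: "(s x \<noteq> y' \<and> s x \<in> s(y := y') ` fn P) \<longleftrightarrow> (x \<noteq> y \<and> x \<in> fn P)" if "y \<in> fn P"
  proof -
    have "(s x \<noteq> y' \<and> s x \<in> s(y := y') ` fn P) \<longleftrightarrow> s x \<in> s(y := y') ` fn P - {y'}"
      by auto
    also have "\<dots> \<longleftrightarrow> s x \<in> s ` (fn P - {y})"
      by (simp only: fun_upd_image_Diff[OF y'])
    also have "\<dots> \<longleftrightarrow> x \<in> fn P - {y}"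
      by (rule inj_on_image_mem_iff[OF injF]) auto
    finally show ?thesis by auto
  qed
  show ?case
    unfolding ren.simps Let_def y'_def[symmetric] wt.simps fn_ren P y comp_apply
    using x by blast
next
  case (Sel x l P)
  have P: "wt (ren P s) (g(s x := A)) = wt P ((g \<circ> s)(x := A))" for A
    using Sel.prems by (subst Sel.IH) (auto intro!: wt_comp_upd simp del: inj_on_insert elim: inj_on_subset)
  have "s x \<in> s ` fn P \<longleftrightarrow> x \<in> fn P"
    by (rule inj_on_image_mem_iff[OF Sel.prems]) auto
  then show ?case by (simp add: P comp_def)
next
  case (Avail x P)
  have P: "wt (ren P s) (g(s x := A)) = wt P ((g \<circ> s)(x := A))" for A
    using Avail.prems by (subst Avail.IH) (auto intro!: wt_comp_upd simp del: inj_on_insert elim: inj_on_subset)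
  have "s x \<in> s ` fn P \<longleftrightarrow> x \<in> fn P"
    by (rule inj_on_image_mem_iff[OF Avail.prems]) auto
  then show ?case by (simp add: P comp_def)
next
  case (Expect x W P)
  have inj: "inj_on s (insert x (fset W \<union> fn P))"
    using Expect.prems by simp
  have injP: "inj_on s (fn P)"
    by (rule inj_on_subset[OF inj]) auto
  have P: "wt (ren P s) (g(s x := A)) = wt P ((g \<circ> s)(x := A))" for A
    unfolding Expect.IH[OF injP] by (rule wt_comp_upd) (rule inj_on_subset[OF inj], auto)
  have x: "s x \<in> s ` fn P \<longleftrightarrow> x \<in> fn P"
    by (rule inj_on_image_mem_iff[OF inj]) auto
  have "s ` fn P - {s x} = s ` (fn P - {x})"
    using inj_on_image_set_diff[OF inj, of "fn P" "{x}"] by auto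
  moreover have "s ` fset W = s ` (fn P - {x}) \<longleftrightarrow> fset W = fn P - {x}"
    by (rule inj_on_image_eq_iff[OF inj]) auto
  ultimately show ?case by (simp add: P x comp_def)
next
  case (Branch x Ps)
  let ?F = "fn (Branch x Ps)"
  have sub: "fn P \<subseteq> ?F" if "fmlookup Ps l = Some P" for l P
    using that by (auto simp: fn_Branch)
  have P: "wt (ren P s) (g(s x := A)) = wt P ((g \<circ> s)(x := A))" if "fmlookup Ps l = Some P" for l P A
  proof -
    have "wt (ren P s) (g(s x := A)) = wt P (g(s x := A) \<circ> s)"
      by (rule Branch.IH)
        (use that inj_on_subset[OF Branch.prems sub[OF that]] in \<open>auto simp: fmlookup_ran'_iff\<close>)
    also have "\<dots> = wt P ((g \<circ> s)(x := A))"
      by (rule wt_comp_upd)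
        (rule inj_on_subset[OF Branch.prems], use sub[OF that] in \<open>auto simp: fn_Branch\<close>)
    finally show ?thesis .
  qed
  let ?Rs = "fmmap (\<lambda>r. r s) (fmmap ren Ps)"
  have F: "fn (ren P s) = fn (Branch (s x) ?Rs) \<longleftrightarrow> fn P = ?F" if "fmlookup Ps l = Some P" for l P
    using inj_on_image_eq_iff[OF Branch.prems sub[OF that] subset_refl] fn_ren[of "Branch x Ps" s]
    by simp
  have a: "(\<forall>P. fmlookup ?Rs l = Some P \<longrightarrow> fn P = fn (Branch (s x) ?Rs)) \<longleftrightarrow>
      (\<forall>P. fmlookup Ps l = Some P \<longrightarrow> fn P = ?F)" for l
    using F[of l] by (cases "fmlookup Ps l") (simp_all del: fn_ren)
  have b: "(\<forall>r A. fmlookup (fmmap wt ?Rs) l = Some r \<longrightarrow> fmlookup As l = Some A \<longrightarrow> r (g(s x := A))) \<longleftrightarrow>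
      (\<forall>r A. fmlookup (fmmap wt Ps) l = Some r \<longrightarrow> fmlookup As l = Some A \<longrightarrow> r ((g \<circ> s)(x := A)))"
    for l As
    using P[of l] by (cases "fmlookup Ps l") simp_all
  show ?case
    unfolding ren.simps wt.simps a b by (simp only: fmdom_map comp_apply)
next
  case (Wait x P)
  have "s x \<in> s ` fn P \<longleftrightarrow> x \<in> fn P"
    by (rule inj_on_image_mem_iff[OF Wait.prems]) auto
  then show ?case
    using Wait by simp
next
  case (Par P Q)
  have "s ` fn P \<inter> s ` fn Q = s ` (fn P \<inter> fn Q)"
    by (rule inj_on_image_Int[symmetric]) (use Par.prems in auto)
  then show ?case
    using Par by (simp add: inj_on_Un)
qed auto

lemma fn_subst: "fn (P\<lbrace>y/z\<rbrace>) = (if z \<in> fn P then insert y (fn P - {z}) else fn P)"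
  by (auto simp: subst_def image_iff)

text \<open>The hypothesis makes the substitution injective on the free names; identifying two free
  names could break linearity.\<close>

lemma wt_subst:
  assumes "y \<notin> fn P - {z}"
  shows "wt (P\<lbrace>y/z\<rbrace>) g \<longleftrightarrow> wt P (g(z := g y))"
proof -
  have "inj_on (id(z := y)) (fn P)"
    using assms by (auto simp: inj_on_def)
  then have "wt (P\<lbrace>y/z\<rbrace>) g \<longleftrightarrow> wt P (g \<circ> id(z := y))"
    by (simp add: subst_def wt_ren)
  also have "g \<circ> id(z := y) = g(z := g y)"
    by auto
  finally show ?thesis .
qed

section \<open>Structural congruence\<close>

text \<open>Equality of free names is included because the side conditions of a surrounding process
  inspect them; without it the relation would not be a congruence.\<close>

definition ty_equiv :: "proc \<Rightarrow> proc \<Rightarrow> bool" where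
  "ty_equiv P Q \<longleftrightarrow> fn P = fn Q \<and> (\<forall>g. wt P g \<longleftrightarrow> wt Q g)"

text \<open>Stated for any generating relation, since it is applied to the alpha axioms and then to
  the structural axioms. It rests on \<open>wt\<close> being compositional in the free names and the
  typability of components.\<close>

lemma congruence_closure_ty_equiv:
  assumes "congruence_closure R P Q" and "\<And>P Q. R P Q \<Longrightarrow> ty_equiv P Q"
  shows "ty_equiv P Q"
  using assms(1)
proof induction
  case (base P Q)
  then show ?case by (rule assms(2))
next
  case (Branch Ps Ps' x)
  have eq: "rel_option ty_equiv (fmlookup Ps l) (fmlookup Ps' l)" for l
  proof (cases "fmlookup Ps l")
    case None
    then have "fmlookup Ps' l = None"
      using Branch.hyps by (metis fmdom_notD fmdom_notI)
    with None show ?thesis by simp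
  next
    case (Some P)
    then obtain P' where "fmlookup Ps' l = Some P'"
      using Branch.hyps by (metis fmdomI fmlookup_dom_iff)
    with Some Branch.IH show ?thesis by simp
  qed
  have F: "fn (Branch x Ps) = fn (Branch x Ps')"
  proof -
    have "(\<exists>P. fmlookup Ps l = Some P \<and> z \<in> fn P) \<longleftrightarrow> (\<exists>P. fmlookup Ps' l = Some P \<and> z \<in> fn P)" for l z
      using eq[of l] by (cases rule: option.rel_cases) (auto simp: ty_equiv_def)
    then show ?thesis
      by (simp add: set_eq_iff fn_Branch)
  qed
  have a: "(\<forall>P. fmlookup Ps l = Some P \<longrightarrow> fn P = fn (Branch x Ps)) \<longleftrightarrow>
      (\<forall>P. fmlookup Ps' l = Some P \<longrightarrow> fn P = fn (Branch x Ps'))" for l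
    using eq[of l] by (cases rule: option.rel_cases) (auto simp: ty_equiv_def F)
  have b: "(\<forall>r A. fmlookup (fmmap wt Ps) l = Some r \<longrightarrow> fmlookup As l = Some A \<longrightarrow> r (g(x := A))) \<longleftrightarrow>
      (\<forall>r A. fmlookup (fmmap wt Ps') l = Some r \<longrightarrow> fmlookup As l = Some A \<longrightarrow> r (g(x := A)))"
    for l As g
    using eq[of l] by (cases rule: option.rel_cases) (auto simp: ty_equiv_def fmlookup_map)
  have "wt (Branch x Ps) g \<longleftrightarrow> wt (Branch x Ps') g" for g
    unfolding wt.simps Branch.hyps a b ..
  with F show ?case
    by (simp add: ty_equiv_def)
qed (auto simp: ty_equiv_def)

lemma alpha_equiv_ty_equiv: "alpha_equiv P Q \<Longrightarrow> ty_equiv P Q"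
  unfolding alpha_equiv_def
proof (erule congruence_closure_ty_equiv)
  fix P Q
  assume "alpha_ax P Q"
  then show "ty_equiv P Q"
  proof cases
    case (1 z P Q x)
    have "wt (P\<lbrace>z/x\<rbrace>) (g(z := A)) \<longleftrightarrow> wt P (g(x := A))"
      "wt (Q\<lbrace>z/x\<rbrace>) (g(z := A)) \<longleftrightarrow> wt Q (g(x := A))" for g A
      using 1 by (auto simp: wt_subst intro!: wt_cong)
    then show ?thesis
      using 1 by (auto simp: ty_equiv_def fn_subst)
  next
    case (2 z P x y Q)
    have "wt (P\<lbrace>z/y\<rbrace>) (g(z := A)) \<longleftrightarrow> wt P (g(y := A))" for g A
      using 2 by (auto simp: wt_subst intro!: wt_cong)
    then show ?thesis
      using 2 by (auto simp: ty_equiv_def fn_subst)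
  next
    case (3 z P x y)
    have "wt (P\<lbrace>z/y\<rbrace>) (g(x := B, z := A)) \<longleftrightarrow> wt P (g(x := B, y := A))" for g A B
      using 3 by (auto simp: wt_subst intro!: wt_cong)
    \<comment> \<open>If \<open>z\<close> equals \<open>x\<close>, then \<open>x\<close> is not free
      in \<open>P\<close>, and neither side is typable.\<close>
    then show ?thesis
      using 3 by (auto simp: ty_equiv_def fn_subst)
  qed
qed

lemma fmmap_ident: "(\<And>A. A \<in> fmran' As \<Longrightarrow> f A = A) \<Longrightarrow> fmmap f As = As"
  by (rule fmap_ext) (auto simp: map_option_case fmran'I split: option.split)

lemma dual_dual [simp]: "dual (dual A) = A"
  by (induction A) (simp_all add: fmap.map_comp fmmap_ident)

lemma struct_ax_ty_equiv: "struct_ax P Q \<Longrightarrow> ty_equiv P Q"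
proof (induction rule: struct_ax.induct)
  case (1 P P')
  then show ?case by (rule alpha_equiv_ty_equiv)
next
  case (2 x y)
  then show ?case by (auto simp: ty_equiv_def)
next
  case (6 x P Q)
  \<comment> \<open>The witness for the swapped connection is the dual type, duality being
    involutive.\<close>
  have "(\<exists>A. wt P (g(x := A)) \<and> wt Q (g(x := dual A))) \<longleftrightarrow>
      (\<exists>A. wt Q (g(x := A)) \<and> wt P (g(x := dual A)))" for g
    by (metis dual_dual)
  then show ?case by (simp add: ty_equiv_def Un_commute Int_commute)
next
  case (10 x Q P R)
  then have "fn (Conn x (P \<parallel> Q) R) = fn (Conn x P R \<parallel> Q)"
    by auto
  moreover have "wt (Conn x (P \<parallel> Q) R) g \<longleftrightarrow> wt (Conn x P R \<parallel> Q) g" for g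
  proof -
    have "fn P \<inter> fn Q = {} \<and> (fn P \<union> fn Q) \<inter> fn R = {x} \<longleftrightarrow>
        fn P \<inter> fn R = {x} \<and> (fn P \<union> fn R - {x}) \<inter> fn Q = {}"
      using 10 by blast
    then show ?thesis using 10 by auto
  qed
  ultimately show ?case by (simp add: ty_equiv_def)
next
  case (11 x y Q R P)
  then have "fn (Conn x (Conn y P Q) R) = fn (Conn y (Conn x P R) Q)"
    by auto
  moreover have "wt (Conn x (Conn y P Q) R) g \<longleftrightarrow> wt (Conn y (Conn x P R) Q) g" for g
  proof -
    \<comment> \<open>Both sides say that \<open>P\<close> shares exactly \<open>y\<close> with
      \<open>Q\<close> and exactly \<open>x\<close> with \<open>R\<close>, while \<open>Q\<close>
      and \<open>R\<close> share nothing.\<close>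
    have "fn P \<inter> fn Q = {y} \<and> (fn P \<union> fn Q - {y}) \<inter> fn R = {x} \<longleftrightarrow>
        fn P \<inter> fn R = {x} \<and> (fn P \<union> fn R - {x}) \<inter> fn Q = {y}"
      using 11 by blast
    moreover have "wt P (g(x := A, y := B)) \<longleftrightarrow> wt P (g(y := B, x := A))"
      "wt Q (g(x := A, y := B)) \<longleftrightarrow> wt Q (g(y := B))"
      "wt R (g(y := A, x := B)) \<longleftrightarrow> wt R (g(x := B))" for A B
      using 11 by (auto simp: fun_upd_twist[of x y] intro!: wt_cong)
    ultimately show ?thesis
      unfolding wt.simps fn.simps by metis
  qed
  ultimately show ?case by (simp add: ty_equiv_def)
qed (auto simp: ty_equiv_def)

lemma struct_cong_ty_equiv: "P \<equiv>\<^sub>s Q \<Longrightarrow> ty_equiv P Q"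
  unfolding struct_cong_def
  by (erule congruence_closure_ty_equiv) (rule struct_ax_ty_equiv)

section \<open>Filling D-contexts\<close>

text \<open>In a typed D-context the types of the captured names are determined independently of the
  process in the hole.  A process in the hole may therefore be exchanged for one that no longer
  uses the names \<open>X\<close> as before, and uses names \<open>Y\<close> instead.\<close>

definition hole_typing :: "ctx \<Rightarrow> proc \<Rightarrow> (name \<Rightarrow> ty) \<Rightarrow> (name \<Rightarrow> ty) \<Rightarrow> bool" where
  "hole_typing C A g h \<longleftrightarrow> wt A h \<and> (\<forall>z. z \<notin> captured C \<longrightarrow> h z = g z) \<and>
    (\<forall>B X Y g'. fn B = fn A - X \<union> Y \<and> X \<subseteq> fn A \<and> (X \<union> Y) \<inter> captured C = {} \<and>
        Y \<inter> fn (C\<langle>A\<rangle>) \<subseteq> X \<and> (\<forall>z \<in> fn (C\<langle>A\<rangle>) - X. g' z = g z) \<and>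
        wt B (\<lambda>z. if z \<in> captured C then h z else g' z) \<longrightarrow>
      wt (C\<langle>B\<rangle>) g' \<and> fn (C\<langle>B\<rangle>) = fn (C\<langle>A\<rangle>) - X \<union> Y \<and> X \<subseteq> fn (C\<langle>A\<rangle>))"

lemma hole_typingD:
  assumes "hole_typing C A g h"
  shows "wt A h" "z \<notin> captured C \<Longrightarrow> h z = g z"
  using assms by (simp_all add: hole_typing_def)

lemma hole_typing_fill:
  assumes "hole_typing C A g h"
    and "fn B = fn A - X \<union> Y" "X \<subseteq> fn A" "(X \<union> Y) \<inter> captured C = {}" "Y \<inter> fn (C\<langle>A\<rangle>) \<subseteq> X"
    and "\<And>z. z \<in> fn (C\<langle>A\<rangle>) - X \<Longrightarrow> g' z = g z"
    and "wt B (\<lambda>z. if z \<in> captured C then h z else g' z)"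
  shows "wt (C\<langle>B\<rangle>) g' \<and> fn (C\<langle>B\<rangle>) = fn (C\<langle>A\<rangle>) - X \<union> Y \<and> X \<subseteq> fn (C\<langle>A\<rangle>)"
  using assms(1)[unfolded hole_typing_def, THEN conjunct2, THEN conjunct2,
      THEN spec[of _ B], THEN spec[of _ X], THEN spec[of _ Y], THEN spec[of _ g'], THEN mp]
    assms(2-) by simp

text \<open>\<open>h\<close> records the witnesses chosen at the connections on the way to the hole;
  a replacement reuses them. Choice is excluded from the contexts because an untouched alternative
  would keep the old free names.\<close>

lemma hole_typing_exists:
  assumes "dctx C" "wt (C\<langle>A\<rangle>) g"
  shows "\<exists>h. hole_typing C A g h"
  using assms
proof (induction C arbitrary: g)
  case Hole
  then show ?case by (auto simp: hole_typing_def)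
next
  case (CPar C R)
  then have d: "fn (C\<langle>A\<rangle>) \<inter> fn R = {}" and R: "wt R g" and "dctx C" "wt (C\<langle>A\<rangle>) g"
    by auto
  from CPar.IH[OF this(3,4)] obtain h where h: "hole_typing C A g h" ..
  note fill = hole_typing_fill[OF h]
  show ?case
    unfolding hole_typing_def
  proof (intro exI[of _ h] conjI allI impI; (elim conjE)?)
    fix B X Y g'
    assume *: "fn B = fn A - X \<union> Y" "X \<subseteq> fn A" "(X \<union> Y) \<inter> captured (CPar C R) = {}"
      "Y \<inter> fn ((CPar C R)\<langle>A\<rangle>) \<subseteq> X" "\<forall>z \<in> fn ((CPar C R)\<langle>A\<rangle>) - X. g' z = g z"
      "wt B (\<lambda>z. if z \<in> captured (CPar C R) then h z else g' z)"
    then have B: "wt (C\<langle>B\<rangle>) g' \<and> fn (C\<langle>B\<rangle>) = fn (C\<langle>A\<rangle>) - X \<union> Y \<and> X \<subseteq> fn (C\<langle>A\<rangle>)"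
      by (intro fill) auto
    \<comment> \<open>\<open>X\<close> lies inside \<open>fn (C\<langle>A\<rangle>)\<close>, which
      is disjoint from the free names of the sibling \<open>R\<close>, so \<open>R\<close> does not
      notice the change.\<close>
    have "g z = g' z" if "z \<in> fn R" for z
    proof -
      have "z \<notin> X" using B d that by blast
      then show ?thesis using *(5) that by simp
    qed
    then have "wt R g'"
      by (rule wt_cong[THEN iffD1, OF _ R])
    moreover have "fn (C\<langle>B\<rangle>) \<inter> fn R = {}"
      using * B d by auto
    ultimately show "wt ((CPar C R)\<langle>B\<rangle>) g'"
      using B by simp
    show "fn ((CPar C R)\<langle>B\<rangle>) = fn ((CPar C R)\<langle>A\<rangle>) - X \<union> Y" "X \<subseteq> fn ((CPar C R)\<langle>A\<rangle>)"
      using B d by auto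
  qed (use hole_typingD[OF h] in auto)
next
  case (CConn x C R)
  then obtain T where d: "fn (C\<langle>A\<rangle>) \<inter> fn R = {x}" and R: "wt R (g(x := dual T))"
    and "dctx C" "wt (C\<langle>A\<rangle>) (g(x := T))"
    by auto
  from CConn.IH[OF this(3,4)] obtain h where h: "hole_typing C A (g(x := T)) h" ..
  note fill = hole_typing_fill[OF h]
  show ?case
    unfolding hole_typing_def
  proof (intro exI[of _ h] conjI allI impI; (elim conjE)?)
    fix B X Y g'
    assume *: "fn B = fn A - X \<union> Y" "X \<subseteq> fn A" "(X \<union> Y) \<inter> captured (CConn x C R) = {}"
      "Y \<inter> fn ((CConn x C R)\<langle>A\<rangle>) \<subseteq> X" "\<forall>z \<in> fn ((CConn x C R)\<langle>A\<rangle>) - X. g' z = g z"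
      "wt B (\<lambda>z. if z \<in> captured (CConn x C R) then h z else g' z)"
    \<comment> \<open>If the inner context does not capture \<open>x\<close> again, then
      \<open>h x\<close> is \<open>T\<close>; otherwise both sides already use \<open>h\<close>.
      Capturing \<open>x\<close> thus absorbs the update.\<close>
    have eq: "(\<lambda>z. if z \<in> captured C then h z else (g'(x := T)) z) =
        (\<lambda>z. if z \<in> captured (CConn x C R) then h z else g' z)"
      using hole_typingD(2)[OF h] by auto
    have x: "x \<notin> X" "x \<notin> Y" using * by auto
    have B: "wt (C\<langle>B\<rangle>) (g'(x := T)) \<and> fn (C\<langle>B\<rangle>) = fn (C\<langle>A\<rangle>) - X \<union> Y \<and> X \<subseteq> fn (C\<langle>A\<rangle>)"
      by (rule fill) (use * x in \<open>auto simp: eq\<close>)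
    have "(g(x := dual T)) z = (g'(x := dual T)) z" if "z \<in> fn R" for z
    proof -
      have "z \<notin> X" using B d that x by auto
      then show ?thesis using *(5) that by simp
    qed
    then have "wt R (g'(x := dual T))"
      by (rule wt_cong[THEN iffD1, OF _ R])
    moreover have "fn (C\<langle>B\<rangle>) \<inter> fn R = {x}"
      using * B d x by auto
    ultimately show "wt ((CConn x C R)\<langle>B\<rangle>) g'"
      using B by auto
    show "fn ((CConn x C R)\<langle>B\<rangle>) = fn ((CConn x C R)\<langle>A\<rangle>) - X \<union> Y" "X \<subseteq> fn ((CConn x C R)\<langle>A\<rangle>)"
      using B d x by auto
  qed (use hole_typingD[OF h] in auto)
qed auto

lemma fn_hole_subset: "fn A - captured C \<subseteq> fn (C\<langle>A\<rangle>)"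
  by (induction C) auto

lemma fn_fill_cong: "fn B = fn A \<Longrightarrow> fn (N\<langle>B\<rangle>) = fn (N\<langle>A\<rangle>)"
  by (induction N) auto

text \<open>Equal free names keep every side condition along the path, including the one at a
  choice, so arbitrary ND-contexts are covered.\<close>

lemma wt_fill_mono:
  assumes "\<And>g. wt A g \<Longrightarrow> wt B g" "fn B = fn A" "wt (N\<langle>A\<rangle>) g"
  shows "wt (N\<langle>B\<rangle>) g"
  using assms(1,3) by (induction N arbitrary: g) (auto simp: fn_fill_cong[OF assms(2)])

lemma fn_fill_Choice: "fn (C\<langle>P \<boxplus> Q\<rangle>) = fn (C\<langle>P\<rangle>) \<union> fn (C\<langle>Q\<rangle>)"
  by (induction C) auto

text \<open>Both copies inherit the same cut types. The converse fails in general, since two copies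
  typed separately may choose different ones.\<close>

lemma wt_fill_Choice: "wt (C\<langle>P \<boxplus> Q\<rangle>) g \<Longrightarrow> wt (C\<langle>P\<rangle> \<boxplus> C\<langle>Q\<rangle>) g"
  by (induction C arbitrary: g) (auto simp: fn_fill_Choice)

section \<open>Choices among filled D-contexts\<close>

lemma fn_choice: "fn (choice Ps) = (\<Union>P\<in>set Ps. fn P)"
  by (induction Ps rule: choice.induct) auto

lemma wt_choice:
  "Ps \<noteq> [] \<Longrightarrow> wt (choice Ps) g \<longleftrightarrow> (\<forall>P\<in>set Ps. fn P = fn (choice Ps) \<and> wt P g)"
  by (induction Ps rule: choice.induct) (auto simp: fn_choice)

lemma wt_bigchoice_hole:
  assumes "wt (\<boxplus>i<m. (C i)\<langle>A i\<rangle>) g" "i < m" "dctx (C i)"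
  shows "\<exists>h. wt (A i) h \<and> (\<forall>z. z \<notin> captured (C i) \<longrightarrow> h z = g z)"
proof -
  have "wt ((C i)\<langle>A i\<rangle>) g"
    using assms(1,2) by (subst (asm) wt_choice) auto
  from hole_typing_exists[OF assms(3) this] obtain h where "hole_typing (C i) (A i) g h" ..
  from hole_typingD[OF this] show ?thesis by auto
qed

text \<open>The common core of the redex rules. \<open>T\<close> is the type of \<open>x\<close>
  after the step: the continuation type if \<open>x\<close> survives (then \<open>x\<close> is in
  \<open>Y\<close>), and otherwise the original value of the assignment at \<open>x\<close>, so that
  the update for the cut is undone.\<close>

lemma wt_bigchoice_fill:
  assumes "0 < m" and C: "\<And>i. i < m \<Longrightarrow> dctx (C i) \<and> x \<notin> captured (C i)"
    and wt: "wt (\<boxplus>i<m. (C i)\<langle>A i\<rangle>) g" and F: "fn (\<boxplus>i<m. (C i)\<langle>A i\<rangle>) = F"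
    and Y: "Y \<inter> F \<subseteq> {x}" "\<And>i. i < m \<Longrightarrow> Y \<inter> captured (C i) = {}"
    and B: "\<And>i h. i < m \<Longrightarrow> wt (A i) h \<Longrightarrow> (\<And>z. z \<notin> captured (C i) \<Longrightarrow> h z = g z) \<Longrightarrow>
      fn (A i) \<subseteq> F \<union> captured (C i) \<Longrightarrow>
      x \<in> fn (A i) \<and> fn (B i) = fn (A i) - {x} \<union> Y \<and> wt (B i) (h(x := T))"
  shows "wt (\<boxplus>i<m. (C i)\<langle>B i\<rangle>) (g(x := T)) \<and> fn (\<boxplus>i<m. (C i)\<langle>B i\<rangle>) = F - {x} \<union> Y"
proof -
  have "map (\<lambda>i. (C i)\<langle>A i\<rangle>) [0..<m] \<noteq> []"
    using \<open>0 < m\<close> by simp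
  from wt[unfolded wt_choice[OF this] F]
  have wt_all: "\<forall>i<m. fn ((C i)\<langle>A i\<rangle>) = F \<and> wt ((C i)\<langle>A i\<rangle>) g"
    by simp
  have *: "wt ((C i)\<langle>B i\<rangle>) (g(x := T)) \<and> fn ((C i)\<langle>B i\<rangle>) = F - {x} \<union> Y" if i: "i < m" for i
  proof -
    have wti: "wt ((C i)\<langle>A i\<rangle>) g" and Fi: "fn ((C i)\<langle>A i\<rangle>) = F"
      using wt_all i by blast+
    from hole_typing_exists[OF _ wti] C[OF i] obtain h where h: "hole_typing (C i) (A i) g h"
      by auto
    have "fn (A i) \<subseteq> F \<union> captured (C i)"
      using fn_hole_subset[of "A i" "C i"] Fi by auto
    from B[OF i hole_typingD[OF h] this] have Bi: "x \<in> fn (A i)" "fn (B i) = fn (A i) - {x} \<union> Y" "wt (B i) (h(x := T))"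
      by auto
    have "h(x := T) = (\<lambda>z. if z \<in> captured (C i) then h z else (g(x := T)) z)"
      using C[OF i] hole_typingD(2)[OF h] by auto
    then show ?thesis
      using hole_typing_fill[OF h, of "B i" "{x}" Y "g(x := T)"] Bi Y(1) Y(2)[OF i] C[OF i]
      by (simp add: Fi)
  qed
  have fnB: "fn (\<boxplus>i<m. (C i)\<langle>B i\<rangle>) = F - {x} \<union> Y"
    using * \<open>0 < m\<close> by (auto simp: fn_choice)
  moreover have "wt (\<boxplus>i<m. (C i)\<langle>B i\<rangle>) (g(x := T))"
    using * \<open>0 < m\<close> by (subst wt_choice) (auto simp: fnB)
  ultimately show ?thesis by blast
qed

section \<open>Subject reduction\<close>

lemma fn_parallel_Unavail: "fn (parallel (map Unavail ws)) = set ws"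
  by (induction ws rule: induct_list012) auto

lemma wt_parallel_Unavail:
  "distinct ws \<Longrightarrow> (\<And>w. w \<in> set ws \<Longrightarrow> \<exists>B. g w = Amp B) \<Longrightarrow> wt (parallel (map Unavail ws)) g"
proof (induction ws rule: induct_list012)
  case (3 v w ws)
  then show ?case
    using fn_parallel_Unavail[of "w # ws"] by auto
qed auto

text \<open>Every summand is typed by the same assignment and has the free names of the whole, so
  any non-empty selection does too.\<close>

lemma wt_choice_subset:
  assumes "wt (choice Ps) g" "set Qs \<subseteq> set Ps" "Qs \<noteq> []"
  shows "wt (choice Qs) g \<and> fn (choice Qs) = fn (choice Ps)"
proof -
  have P: "fn P = fn (choice Ps) \<and> wt P g" if "P \<in> set Ps" for P
    using assms that by (subst (asm) wt_choice) auto
  then have "fn (choice Qs) = fn (choice Ps)"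
    using assms(2,3) by (subst fn_choice) (cases Qs; auto)
  with P show ?thesis
    using assms(2,3) by (auto simp: wt_choice)
qed

lemma precong_wt:
  assumes "P \<succeq>\<^bsub>S\<^esub> P'" "wt P g"
  shows "wt P' g \<and> fn P' = fn P"
  using assms
proof cases
  case precong_single
  show ?thesis
    using assms(2) unfolding precong_single(1,3)
    by (rule wt_choice_subset) (use precong_single in auto)
next
  case precong_fwd
  show ?thesis
    using assms(2) unfolding precong_fwd(1,3)
    by (rule wt_choice_subset) (use precong_fwd in auto)
qed

text \<open>Preservation of \<open>fn\<close> is part of the induction because the closure rules
  must re-establish side conditions on it; \<open>g\<close> varies because a connection changes the
  assignment for its components.\<close>

lemma reduce_wt: "P \<leadsto>\<^bsub>S\<^esub> Q \<Longrightarrow> wt P g \<Longrightarrow> wt Q g \<and> fn Q = fn P"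
proof (induction arbitrary: g rule: reduce.induct)
  case (red_Id m C x Q y)
  let ?L = "\<boxplus>i<m. (C i)\<langle>Fwd x y\<rangle>"
  from red_Id.prems obtain T where FG: "fn ?L \<inter> fn Q = {x}"
    and L: "wt ?L (g(x := T))" and Q: "wt Q (g(x := dual T))"
    by auto
  \<comment> \<open>The hole loses \<open>x\<close> and gains the names of \<open>Q\<close> other
    than \<open>x\<close>; resetting \<open>x\<close> to \<open>g x\<close> turns the assignment
    back into \<open>g\<close>.\<close>
  have "wt (\<boxplus>i<m. (C i)\<langle>Q\<lbrace>y/x\<rbrace>\<rangle>) ((g(x := T))(x := g x)) \<and>
      fn (\<boxplus>i<m. (C i)\<langle>Q\<lbrace>y/x\<rbrace>\<rangle>) = fn ?L - {x} \<union> (fn Q - {x})"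
  proof (rule wt_bigchoice_fill[OF red_Id.hyps(1) _ L HOL.refl])
    fix i h
    assume i: "i < m" and w: "wt (Fwd x y) h"
      and h: "\<And>z. z \<notin> captured (C i) \<Longrightarrow> h z = (g(x := T)) z"
      and sub: "fn (Fwd x y) \<subseteq> fn ?L \<union> captured (C i)"
    note C = red_Id.hyps(2)[OF i]
    \<comment> \<open>\<open>y\<close> is either captured by the context, hence not free in
      \<open>Q\<close>, or free in the left component, which shares only \<open>x\<close> with
      \<open>Q\<close>. The forwarder's typing gives \<open>y\<close> the type that \<open>Q\<close>
      expects of \<open>x\<close>.\<close>
    have y: "y \<notin> fn Q" "x \<noteq> y" and hy: "h y = dual T"
      using sub C FG w h[of x] by auto
    have hQ: "h z = g z" if "z \<in> fn Q" "z \<noteq> x" for z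
      using h[of z] that C by auto
    have "wt (Q\<lbrace>y/x\<rbrace>) (h(x := g x)) \<longleftrightarrow> wt Q (g(x := dual T))"
      by (subst wt_subst) (use y hy hQ in \<open>auto intro!: wt_cong\<close>)
    with Q FG y show "x \<in> fn (Fwd x y) \<and> fn (Q\<lbrace>y/x\<rbrace>) = fn (Fwd x y) - {x} \<union> (fn Q - {x}) \<and>
        wt (Q\<lbrace>y/x\<rbrace>) (h(x := g x))"
      by (auto simp: fn_subst)
  qed (use red_Id.hyps FG in auto)
  then show ?case
    by (auto simp: Un_Diff)
next
  case (red_Comm m n C x D z R w P y Q)
  let ?L = "\<boxplus>i<m. (C i)\<langle>Out x (y i) (P i) (Q i)\<rangle>"
  let ?R = "\<boxplus>j<n. (D j)\<langle>In x z (R j)\<rangle>"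
  let ?R' = "\<boxplus>j<n. (D j)\<langle>(R j)\<lbrace>w/z\<rbrace>\<rangle>"
  from red_Comm.prems obtain T where FG: "fn ?L \<inter> fn ?R = {x}"
    and L: "wt ?L (g(x := T))" and R: "wt ?R (g(x := dual T))"
    by auto
  \<comment> \<open>Summand 0 suffices: \<open>x\<close> is not captured there, so the redex sees
    the cut type \<open>T\<close> itself.\<close>
  obtain A B where T: "T = Tensor A B"
    using wt_bigchoice_hole[OF L \<open>0 < m\<close>] red_Comm.hyps(3)[OF \<open>0 < m\<close>] by auto
  have CR: "captured (C i) \<inter> fn ?R = {}" if "i < m" for i
    using red_Comm.hyps(5)[OF that] by (simp add: fn_choice Int_UN_distrib)
  have w: "w \<notin> fn ?R"
    using red_Comm.hyps(8) by (auto simp: fn_choice)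
  \<comment> \<open>\<open>w\<close> receives its type in advance, which is harmless because it is
    not free before the step. The receivers are retyped once, and the result serves all
    senders.\<close>
  have R': "wt ?R' (g(x := dual T, w := dual A, x := dual B)) \<and> fn ?R' = fn ?R - {x} \<union> {x, w}"
  proof (rule wt_bigchoice_fill[OF \<open>0 < n\<close> _ _ HOL.refl])
    show "wt ?R (g(x := dual T, w := dual A))"
      using R w by simp
  next
    fix j h
    assume j: "j < n" and wj: "wt (In x z (R j)) h"
      and h: "\<And>u. u \<notin> captured (D j) \<Longrightarrow> h u = (g(x := dual T, w := dual A)) u"
    note D = red_Comm.hyps(4,8)[OF j]
    have hx: "h x = Parr (dual A) (dual B)" and hw: "h w = dual A"
      using h[of x] h[of w] D \<open>w \<noteq> x\<close> T by auto
    have "wt ((R j)\<lbrace>w/z\<rbrace>) (h(x := dual B)) \<longleftrightarrow> wt (R j) (h(x := dual B, z := dual A))"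
      using D hw \<open>w \<noteq> x\<close> by (auto simp: wt_subst)
    with wj hx D show "x \<in> fn (In x z (R j)) \<and> fn ((R j)\<lbrace>w/z\<rbrace>) = fn (In x z (R j)) - {x} \<union> {x, w} \<and>
        wt ((R j)\<lbrace>w/z\<rbrace>) (h(x := dual B))"
      by (auto simp: fn_subst)
  qed (use red_Comm.hyps(4,8) w in auto)
  then have fnR': "fn ?R' = insert w (fn ?R)"
    using FG by auto
  let ?N = "\<lambda>i. Conn x (Q i) (Conn w ((P i)\<lbrace>w/y i\<rbrace>) ?R')"
  have "wt (\<boxplus>i<m. (C i)\<langle>?N i\<rangle>) (g(x := T, x := g x)) \<and>
      fn (\<boxplus>i<m. (C i)\<langle>?N i\<rangle>) = fn ?L - {x} \<union> (fn ?R - {x})"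
  proof (rule wt_bigchoice_fill[OF \<open>0 < m\<close> _ L HOL.refl])
    fix i h
    assume i: "i < m" and wi: "wt (Out x (y i) (P i) (Q i)) h"
      and h: "\<And>u. u \<notin> captured (C i) \<Longrightarrow> h u = (g(x := T)) u"
      and sub: "fn (Out x (y i) (P i) (Q i)) \<subseteq> fn ?L \<union> captured (C i)"
    note C = CR[OF i]
    have wP: "w \<notin> fn (P i)"
      using red_Comm.hyps(7)[OF i] .
    have hx: "h x = Tensor A B"
      using h[of x] red_Comm.hyps(3)[OF i] T by simp
    with wi have fns: "y i \<in> fn (P i)" "x \<in> fn (Q i)" "(fn (P i) - {y i}) \<inter> fn (Q i) = {}"
      and P: "wt (P i) (h(y i := A))" and Q: "wt (Q i) (h(x := B))"
      by auto
    have hR: "h u = g u" if "u \<in> fn ?R" "u \<noteq> x" for u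
      using h[of u] that C by auto
    \<comment> \<open>Such a name is free in the left component or captured by \<open>C i\<close>;
      the former meets the receivers only in \<open>x\<close>, the latter not at all.\<close>
    have notR: "u \<notin> fn ?R" if "u \<in> fn (P i) - {y i} \<union> fn (Q i)" "u \<noteq> x" for u
    proof -
      have "u \<in> fn ?L \<or> u \<in> captured (C i)"
        using sub that by auto
      then show ?thesis
        using C FG that(2) by blast
    qed
    have "x \<in> fn ?R"
      using FG by blast
    with notR fns have sub': "fn (Q i) \<inter> fn ?R = {x}" "(fn (P i) - {y i}) \<inter> fn ?R = {}"
      by blast+
    have fnP': "fn ((P i)\<lbrace>w/y i\<rbrace>) = insert w (fn (P i) - {y i})"
      using fns by (simp add: fn_subst)
    have "wt ((P i)\<lbrace>w/y i\<rbrace>) (h(x := dual B, w := A)) \<longleftrightarrow> wt (P i) (h(y i := A))"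
      using wP fns by (auto simp: wt_subst intro!: wt_cong)
    moreover have "wt ?R' (h(x := dual B, w := dual A)) \<longleftrightarrow> wt ?R' (g(x := dual T, w := dual A, x := dual B))"
      by (rule wt_cong) (use hR \<open>w \<noteq> x\<close> in \<open>auto simp: fnR'\<close>)
    moreover have "fn ((P i)\<lbrace>w/y i\<rbrace>) \<inter> fn ?R' = {w}"
      using sub' wP by (auto simp: fnP' fnR')
    ultimately have inner: "wt (Conn w ((P i)\<lbrace>w/y i\<rbrace>) ?R') (h(x := dual B))"
      using P R' by auto
    have fn_inner: "fn (Conn w ((P i)\<lbrace>w/y i\<rbrace>) ?R') = (fn (P i) - {y i}) \<union> fn ?R"
      using wP w by (auto simp: fnP' fnR')
    have "fn (Q i) \<inter> fn (Conn w ((P i)\<lbrace>w/y i\<rbrace>) ?R') = {x}"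
      unfolding fn_inner using sub' fns by auto
    with Q inner have "wt (?N i) (h(x := g x))"
      unfolding wt.simps(3)[of x] by (intro conjI exI[of _ B]) simp_all
    moreover have "fn (?N i) = fn (Out x (y i) (P i) (Q i)) - {x} \<union> (fn ?R - {x})"
      unfolding fn.simps(3)[of x] fn_inner by auto
    ultimately show "x \<in> fn (Out x (y i) (P i) (Q i)) \<and>
        fn (?N i) = fn (Out x (y i) (P i) (Q i)) - {x} \<union> (fn ?R - {x}) \<and> wt (?N i) (h(x := g x))"
      by simp
  qed (use red_Comm.hyps(3) FG CR in blast)+
  then show ?case
    by (auto simp: Un_Diff)
next
  case (red_Sel m n C x D Qs K k' Q P)
  let ?L = "\<boxplus>i<m. (C i)\<langle>Sel x k' (P i)\<rangle>"
  let ?R = "\<boxplus>j<n. (D j)\<langle>Branch x (Qs j)\<rangle>"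
  from red_Sel.prems obtain T where FG: "fn ?L \<inter> fn ?R = {x}"
    and L: "wt ?L (g(x := T))" and R: "wt ?R (g(x := dual T))"
    by auto
  obtain As A where T: "T = Plus As" "fmlookup As k' = Some A"
    using wt_bigchoice_hole[OF L \<open>0 < m\<close>] red_Sel.hyps(3)[OF \<open>0 < m\<close>] by auto
  have "wt (\<boxplus>i<m. (C i)\<langle>P i\<rangle>) (g(x := T, x := A)) \<and> fn (\<boxplus>i<m. (C i)\<langle>P i\<rangle>) = fn ?L - {x} \<union> {x}"
    by (rule wt_bigchoice_fill[OF \<open>0 < m\<close> _ L HOL.refl])
      (use red_Sel.hyps(3) T in \<open>auto dest: spec\<close>)
  moreover have "wt (\<boxplus>j<n. (D j)\<langle>Q j\<rangle>) (g(x := dual T, x := dual A)) \<and>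
      fn (\<boxplus>j<n. (D j)\<langle>Q j\<rangle>) = fn ?R - {x} \<union> {x}"
  proof (rule wt_bigchoice_fill[OF \<open>0 < n\<close> _ R HOL.refl])
    fix j h
    assume j: "j < n" and wj: "wt (Branch x (Qs j)) h"
      and h: "\<And>u. u \<notin> captured (D j) \<Longrightarrow> h u = (g(x := dual T)) u"
    have "h x = With (fmmap dual As)"
      using h[of x] red_Sel.hyps(4)[OF j] T by simp
    from wt_BranchD[OF wj this, of k' "Q j" "dual A"] red_Sel.hyps(5)[OF j] T
    have "fn (Q j) = fn (Branch x (Qs j))" "wt (Q j) (h(x := dual A))"
      by simp_all
    moreover have "x \<in> fn (Branch x (Qs j))"
      by (simp add: fn_Branch)
    ultimately show "x \<in> fn (Branch x (Qs j)) \<and> fn (Q j) = fn (Branch x (Qs j)) - {x} \<union> {x} \<and>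
        wt (Q j) (h(x := dual A))"
      by auto
  qed (use red_Sel.hyps(4) in auto)
  ultimately show ?case
    using FG by auto
next
  case (red_Close m n C x D Q)
  let ?L = "\<boxplus>i<m. (C i)\<langle>Close x\<rangle>"
  let ?R = "\<boxplus>j<n. (D j)\<langle>Wait x (Q j)\<rangle>"
  from red_Close.prems obtain T where FG: "fn ?L \<inter> fn ?R = {x}"
    and L: "wt ?L (g(x := T))" and R: "wt ?R (g(x := dual T))"
    by auto
  \<comment> \<open>\<open>x\<close> is consumed and nothing replaces it, so \<open>Y\<close> is
    empty and \<open>x\<close> gets back its value under \<open>g\<close>.\<close>
  have "wt (\<boxplus>i<m. (C i)\<langle>\<^bold>0\<rangle>) (g(x := T, x := g x)) \<and> fn (\<boxplus>i<m. (C i)\<langle>\<^bold>0\<rangle>) = fn ?L - {x} \<union> {}"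
    by (rule wt_bigchoice_fill[OF \<open>0 < m\<close> _ L HOL.refl]) (use red_Close.hyps(3) in auto)
  moreover have "wt (\<boxplus>j<n. (D j)\<langle>Q j\<rangle>) (g(x := dual T, x := g x)) \<and>
      fn (\<boxplus>j<n. (D j)\<langle>Q j\<rangle>) = fn ?R - {x} \<union> {}"
    by (rule wt_bigchoice_fill[OF \<open>0 < n\<close> _ R HOL.refl]) (use red_Close.hyps(4) in auto)
  ultimately show ?case
    using FG by auto
next
  case (red_Some m n C x D P W Q)
  let ?L = "\<boxplus>i<m. (C i)\<langle>Avail x (P i)\<rangle>"
  let ?R = "\<boxplus>j<n. (D j)\<langle>Expect x W (Q j)\<rangle>"
  from red_Some.prems obtain T where FG: "fn ?L \<inter> fn ?R = {x}"
    and L: "wt ?L (g(x := T))" and R: "wt ?R (g(x := dual T))"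
    by auto
  obtain A where T: "T = Amp A"
    using wt_bigchoice_hole[OF L \<open>0 < m\<close>] red_Some.hyps(3)[OF \<open>0 < m\<close>] by auto
  have "wt (\<boxplus>i<m. (C i)\<langle>P i\<rangle>) (g(x := T, x := A)) \<and> fn (\<boxplus>i<m. (C i)\<langle>P i\<rangle>) = fn ?L - {x} \<union> {x}"
    by (rule wt_bigchoice_fill[OF \<open>0 < m\<close> _ L HOL.refl])
      (use red_Some.hyps(3) T in \<open>auto dest: spec\<close>)
  moreover have "wt (\<boxplus>j<n. (D j)\<langle>Q j\<rangle>) (g(x := dual T, x := dual A)) \<and>
      fn (\<boxplus>j<n. (D j)\<langle>Q j\<rangle>) = fn ?R - {x} \<union> {x}"
    by (rule wt_bigchoice_fill[OF \<open>0 < n\<close> _ R HOL.refl])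
      (use red_Some.hyps(4) T in \<open>auto dest: spec\<close>)
  ultimately show ?case
    using FG by auto
next
  case (red_None m n C x D ws Q)
  let ?L = "\<boxplus>i<m. (C i)\<langle>Unavail x\<rangle>"
  let ?R = "\<boxplus>j<n. (D j)\<langle>Expect x (fset_of_list ws) (Q j)\<rangle>"
  from red_None.prems obtain T where FG: "fn ?L \<inter> fn ?R = {x}"
    and L: "wt ?L (g(x := T))" and R: "wt ?R (g(x := dual T))"
    by auto
  have "wt (\<boxplus>i<m. (C i)\<langle>\<^bold>0\<rangle>) (g(x := T, x := g x)) \<and> fn (\<boxplus>i<m. (C i)\<langle>\<^bold>0\<rangle>) = fn ?L - {x} \<union> {}"
    by (rule wt_bigchoice_fill[OF \<open>0 < m\<close> _ L HOL.refl]) (use red_None.hyps(3) in auto)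
  \<comment> \<open>In a typed expect the subscript is exactly the set of free names other than
    \<open>x\<close>, all with types \<open>Amp\<close>. The messages on these names therefore fit
    the hole without gaining any name.\<close>
  moreover have "wt (\<boxplus>j<n. (D j)\<langle>parallel (map Unavail ws)\<rangle>) (g(x := dual T, x := g x)) \<and>
      fn (\<boxplus>j<n. (D j)\<langle>parallel (map Unavail ws)\<rangle>) = fn ?R - {x} \<union> {}"
    by (rule wt_bigchoice_fill[OF \<open>0 < n\<close> _ R HOL.refl])
      (use red_None.hyps(4) \<open>distinct ws\<close> in
        \<open>auto simp: fn_parallel_Unavail fset_of_list.rep_eq intro!: wt_parallel_Unavail\<close>)
  ultimately show ?case
    using FG by auto
next
  case (red_precong x S P P' Q Q' R)
  from red_precong.prems obtain A where "fn P \<inter> fn Q = {x}" "wt P (g(x := A))" "wt Q (g(x := dual A))"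
    by auto
  moreover note precong_wt[OF red_precong.hyps(2) this(2)] precong_wt[OF red_precong.hyps(3) this(3)]
  ultimately have "wt (Conn x P' Q') g" "fn (Conn x P' Q') = fn (Conn x P Q)"
    by auto
  with red_precong.IH[of g] show ?case by (simp only:)
next
  case (red_nu_choice C x P N Q1 Q2 S R)
  let ?A = "C\<langle>Q1 \<boxplus> Q2\<rangle>" and ?B = "C\<langle>Q1\<rangle> \<boxplus> C\<langle>Q2\<rangle>"
  have fnAB: "fn ?B = fn ?A" by (simp add: fn_fill_Choice)
  have "fn (N\<langle>?B\<rangle>) = fn (N\<langle>?A\<rangle>)"
    by (rule fn_fill_cong[OF fnAB])
  moreover have "wt (N\<langle>?B\<rangle>) h" if "wt (N\<langle>?A\<rangle>) h" for h
    by (rule wt_fill_mono[OF wt_fill_Choice fnAB that])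
  ultimately have "wt (Conn x P (N\<langle>?B\<rangle>)) g" "fn (Conn x P (N\<langle>?B\<rangle>)) = fn (Conn x P (N\<langle>?A\<rangle>))"
    using red_nu_choice.prems by auto
  with red_nu_choice.IH[of g] show ?case by (simp only:)
next
  case (red_struct P P' S Q' Q)
  from struct_cong_ty_equiv[OF this(1)] struct_cong_ty_equiv[OF this(3)] this(4,5) show ?case
    by (simp add: ty_equiv_def)
next
  case (red_Conn P S P' x Q)
  then obtain A where "fn P \<inter> fn Q = {x}" "wt P (g(x := A))" "wt Q (g(x := dual A))"
    by auto
  moreover have "wt P' (g(x := A)) \<and> fn P' = fn P"
    by (rule red_Conn.IH) fact
  ultimately show ?case by auto
next
  case (red_Par P S P' Q)
  then have "fn P \<inter> fn Q = {}" "wt P g" "wt Q g"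
    by auto
  moreover have "wt P' g \<and> fn P' = fn P"
    by (rule red_Par.IH) fact
  ultimately show ?case by simp
next
  case (red_Choice P S P' Q)
  then have "fn P = fn Q" "wt P g" "wt Q g"
    by auto
  moreover have "wt P' g \<and> fn P' = fn P"
    by (rule red_Choice.IH) fact
  ultimately show ?case by simp
qed

theorem mainTheorem1:
  fixes P :: proc and \<Gamma> :: tctx
  assumes "P \<turnstile> \<Gamma>"
  shows "(\<forall>Q. P \<equiv>\<^sub>s Q \<longrightarrow> Q \<turnstile> \<Gamma>) \<and>
         (\<forall>Q S. S \<noteq> {} \<longrightarrow> P \<leadsto>\<^bsub>S\<^esub> Q \<longrightarrow> Q \<turnstile> \<Gamma>)"
  using assms struct_cong_ty_equiv[of P] reduce_wt[of P _ _ "\<lambda>z. the (fmlookup \<Gamma> z)"]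
  unfolding typed_iff_wt ty_equiv_def by auto

end
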